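(* Let $K$ be a field, let $\mathcal{Q}$ be a bipartite quiver with $d$ vertices and arrows $h_1,\dots,h_r$, and let $\mathbf{m}=(m_\gamma)_{\gamma}$, $\mathbf{u}=(u_\gamma)_\gamma$ be tuples of nonnegative integers indexed by the vertices. Let $I_{\mathcal{Q},\mathbf{m},\mathbf{u}}\subseteq K[X]$ be the bipartite determinantal ideal, i.e. the ideal generated by $\bigcup_{\gamma}D_{u_\gamma+1}(A_\gamma)$. Then this set of natural generators $\bigcup_{\gamma}D_{u_\gamma+1}(A_\gamma)$ is a Gröbner basis of $I_{\mathcal{Q},\mathbf{m},\mathbf{u}}$ with respect to any lexicographic monomial order on $K[X]$ that is consistent with $A_\gamma$ for every vertex $\gamma$.
   Context: A bipartite quiver is a quiver whose vertex set is a disjoint union $V_{\rm source}\sqcup V_{\rm sink}$ such that every arrow $h$ has source ${\rm s}(h)\in V_{\rm source}$ and target ${\rm t}(h)\in V_{\rm sink}$. For each arrow $h_k$ let $X^{(k)}=[x^{(k)}_{ij}]$ be an $m_{{\rm t}(h_k)}\times m_{{\rm s}(h_k)}$ matrix of independent variables (all variables $x^{(k)}_{ij}$, over all $k,i,j$, are distinct), and let $K[X]$ be the polynomial ring in all of them. For a sink $\alpha$, let $r_1<\dots<r_s$ be the indices of all arrows with target $\alpha$ and set $A_\alpha=[X^{(r_1)}|X^{(r_2)}|\cdots|X^{(r_s)}]$ (horizontal concatenation). For a source $\beta$, let $r'_1<\dots<r'_t$ be the indices of all arrows with source $\beta$ and let $A_\beta$ be the vertical stacking of $X^{(r'_1)},\dots,X^{(r'_t)}$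 (in this order, top to bottom). For a matrix $C$ and positive integer $u$, $D_u(C)$ denotes the set of all $u\times u$ minors of $C$. A monomial order $>$ is consistent with a matrix of variables $C=(c_{ij})$ if $c_{ij}>c_{ij'}$ whenever $j'>j$ and $c_{ij}>c_{i'j}$ whenever $i'>i$ (variables decrease from left to right and from top to bottom). *)

theory Defs
  imports "HOL-Library.Poly_Mapping" "HOL-Combinatorics.Permutations"
begin

text \<open>Variables x^(k)_{ij} are encoded as triples (k,i,j) (0-based indices).
  Polynomials over K in variables of type 'x: monomials are exponent vectors
  ('x =>0 nat), polynomials are finitely supported maps monomial \<Rightarrow> coefficient.\<close>

type_synonym qvar = "nat \<times> nat \<times> nat"
type_synonym 'a mpoly = "((qvar \<Rightarrow>\<^sub>0 nat) \<Rightarrow>\<^sub>0 'a)"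

definition Var :: "qvar \<Rightarrow> ('a::comm_ring_1) mpoly" where
  "Var x = Poly_Mapping.single (Poly_Mapping.single x 1) 1"

definition in_KX :: "qvar set \<Rightarrow> ('a::zero) mpoly \<Rightarrow> bool" where
  "in_KX V p \<longleftrightarrow> (\<forall>mon \<in> Poly_Mapping.keys p. Poly_Mapping.keys (mon :: qvar \<Rightarrow>\<^sub>0 nat) \<subseteq> V)"

inductive_set ideal_gen :: "qvar set \<Rightarrow> ('a::comm_ring_1) mpoly set \<Rightarrow> 'a mpoly set"
  for V G where
  zero: "0 \<in> ideal_gen V G"
| add: "g \<in> G \<Longrightarrow> in_KX V c \<Longrightarrow> f \<in> ideal_gen V G \<Longrightarrow> c * g + f \<in> ideal_gen V G"

text \<open>A matrix: number of rows, number of columns, entry function (0-based).\<close>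
type_synonym mat = "nat \<times> nat \<times> (nat \<Rightarrow> nat \<Rightarrow> qvar)"

definition minor :: "mat \<Rightarrow> nat set \<Rightarrow> nat set \<Rightarrow> ('a::comm_ring_1) mpoly" where
  "minor A R C =
    (let e = snd (snd A); rs = sorted_list_of_set R; cs = sorted_list_of_set C; n = card R in
     \<Sum>p \<in> {p. p permutes {..<n}}. of_int (sign p) * (\<Prod>l<n. Var (e (rs ! l) (cs ! p l))))"

definition minors :: "nat \<Rightarrow> mat \<Rightarrow> ('a::comm_ring_1) mpoly set" where
  "minors t A = {minor A R C | R C. R \<subseteq> {..<fst A} \<and> C \<subseteq> {..<fst (snd A)} \<and>
                                     card R = t \<and> card C = t}"

text \<open>Matrix A_\<alpha> of a sink: horizontal concatenation of X^(k) over arrows k with target \<alpha>,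
  in increasing order of k. Columns are indexed by pairs (k,j).\<close>
definition sink_cols :: "nat \<Rightarrow> (nat \<Rightarrow> nat) \<Rightarrow> (nat \<Rightarrow> nat) \<Rightarrow> (nat \<Rightarrow> nat) \<Rightarrow> nat \<Rightarrow> (nat \<times> nat) list" where
  "sink_cols r src tgt m \<alpha> =
     concat (map (\<lambda>k. map (\<lambda>j. (k, j)) [0..<m (src k)]) (filter (\<lambda>k. tgt k = \<alpha>) [0..<r]))"

definition sink_mat :: "nat \<Rightarrow> (nat \<Rightarrow> nat) \<Rightarrow> (nat \<Rightarrow> nat) \<Rightarrow> (nat \<Rightarrow> nat) \<Rightarrow> nat \<Rightarrow> mat" where
  "sink_mat r src tgt m \<alpha> =
     (let cl = sink_cols r src tgt m \<alpha> in
      (m \<alpha>, length cl, \<lambda>i c. (fst (cl ! c), i, snd (cl ! c))))"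

text \<open>Matrix A_\<beta> of a source: vertical stacking of X^(k) over arrows k with source \<beta>,
  in increasing order of k (top to bottom). Rows are indexed by pairs (k,i).\<close>
definition source_rows :: "nat \<Rightarrow> (nat \<Rightarrow> nat) \<Rightarrow> (nat \<Rightarrow> nat) \<Rightarrow> (nat \<Rightarrow> nat) \<Rightarrow> nat \<Rightarrow> (nat \<times> nat) list" where
  "source_rows r src tgt m \<beta> =
     concat (map (\<lambda>k. map (\<lambda>i. (k, i)) [0..<m (tgt k)]) (filter (\<lambda>k. src k = \<beta>) [0..<r]))"

definition source_mat :: "nat \<Rightarrow> (nat \<Rightarrow> nat) \<Rightarrow> (nat \<Rightarrow> nat) \<Rightarrow> (nat \<Rightarrow> nat) \<Rightarrow> nat \<Rightarrow> mat" where
  "source_mat r src tgt m \<beta> =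
     (let rl = source_rows r src tgt m \<beta> in
      (length rl, m \<beta>, \<lambda>i j. (fst (rl ! i), snd (rl ! i), j)))"

definition vertex_mat :: "(nat \<Rightarrow> bool) \<Rightarrow> nat \<Rightarrow> (nat \<Rightarrow> nat) \<Rightarrow> (nat \<Rightarrow> nat) \<Rightarrow> (nat \<Rightarrow> nat) \<Rightarrow> nat \<Rightarrow> mat" where
  "vertex_mat is_source r src tgt m \<gamma> =
     (if is_source \<gamma> then source_mat r src tgt m \<gamma> else sink_mat r src tgt m \<gamma>)"

definition quiver_vars :: "nat \<Rightarrow> (nat \<Rightarrow> nat) \<Rightarrow> (nat \<Rightarrow> nat) \<Rightarrow> (nat \<Rightarrow> nat) \<Rightarrow> qvar set" where
  "quiver_vars r src tgt m = {(k, i, j). k < r \<and> i < m (tgt k) \<and> j < m (src k)}"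

definition lex_gt :: "(qvar \<Rightarrow> qvar \<Rightarrow> bool) \<Rightarrow> qvar set \<Rightarrow> (qvar \<Rightarrow>\<^sub>0 nat) \<Rightarrow> (qvar \<Rightarrow>\<^sub>0 nat) \<Rightarrow> bool" where
  "lex_gt gt V a b \<longleftrightarrow>
     (\<exists>x\<in>V. Poly_Mapping.lookup a x > Poly_Mapping.lookup b x \<and> (\<forall>y\<in>V. gt y x \<longrightarrow> Poly_Mapping.lookup a y = Poly_Mapping.lookup b y))"

definition strict_total_on :: "qvar set \<Rightarrow> (qvar \<Rightarrow> qvar \<Rightarrow> bool) \<Rightarrow> bool" where
  "strict_total_on V gt \<longleftrightarrow>
     (\<forall>x\<in>V. \<not> gt x x) \<and>
     (\<forall>x\<in>V. \<forall>y\<in>V. \<forall>z\<in>V. gt x y \<longrightarrow> gt y z \<longrightarrow> gt x z) \<and>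
     (\<forall>x\<in>V. \<forall>y\<in>V. x \<noteq> y \<longrightarrow> gt x y \<or> gt y x)"

definition lead_mon :: "(qvar \<Rightarrow> qvar \<Rightarrow> bool) \<Rightarrow> qvar set \<Rightarrow> ('a::zero) mpoly \<Rightarrow> (qvar \<Rightarrow>\<^sub>0 nat)" where
  "lead_mon gt V p = (THE a. a \<in> Poly_Mapping.keys p \<and> (\<forall>b\<in>Poly_Mapping.keys p. b \<noteq> a \<longrightarrow> lex_gt gt V a b))"

definition mon_dvd :: "(qvar \<Rightarrow>\<^sub>0 nat) \<Rightarrow> (qvar \<Rightarrow>\<^sub>0 nat) \<Rightarrow> bool" where
  "mon_dvd a b \<longleftrightarrow> (\<forall>x. Poly_Mapping.lookup a x \<le> Poly_Mapping.lookup b x)"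

definition groebner_basis :: "(qvar \<Rightarrow> qvar \<Rightarrow> bool) \<Rightarrow> qvar set \<Rightarrow> ('a::zero) mpoly set \<Rightarrow> 'a mpoly set \<Rightarrow> bool" where
  "groebner_basis gt V G I \<longleftrightarrow> G \<subseteq> I \<and>
     (\<forall>f\<in>I. f \<noteq> 0 \<longrightarrow> (\<exists>g\<in>G. g \<noteq> 0 \<and> mon_dvd (lead_mon gt V g) (lead_mon gt V f)))"

definition consistent_with :: "(qvar \<Rightarrow> qvar \<Rightarrow> bool) \<Rightarrow> mat \<Rightarrow> bool" where
  "consistent_with gt A \<longleftrightarrow>
     (let nr = fst A; nc = fst (snd A); e = snd (snd A) in
      (\<forall>i<nr. \<forall>j<nc. \<forall>j'<nc. j < j' \<longrightarrow> gt (e i j) (e i j')) \<and>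
      (\<forall>i<nr. \<forall>i'<nr. \<forall>j<nc. i < i' \<longrightarrow> gt (e i j) (e i' j)))"

end

theory Submission
  imports Defs "Jordan_Normal_Form.Determinant"
begin

text \<open>
  Substituting X^(k) = P_(t(h_k)) Z^(k) Q_(s(h_k)) with generic factors of sizes m_(t(h_k)) by u_(t(h_k)),
  u_(t(h_k)) by u_(s(h_k)) and u_(s(h_k)) by m_(s(h_k)) kills every generator, since then each A_\<gamma>
  factors through rank u_\<gamma>. Each variable becomes a sum of monomials indexed by colours
  (p, q), p < u_(t(h_k)), q < u_(s(h_k)).

  Suppose that f in the ideal has leading monomial a divisible by no leading monomial (a main diagonal) of
  a generator. Then the support of a has no chain of u_\<gamma> + 1 elements in A_\<gamma>, so every variable of the
  support can be coloured by its height in the sink matrix and its height in the source matrix that contain it.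
  Let \<mu> be the monomial of this colouring. Among all coloured monomials b \<le> a the chosen colouring of a is the
  only one that yields \<mu>; hence \<mu> occurs in the image of f with the leading coefficient of f,
  although this image is 0.
\<close>

section \<open>Heights in blockwise orders\<close>

text \<open>Membership in the ideal enters only through a ring homomorphism that kills it, so no
  S-pairs and no reductions occur. The obstacle is that every variable lies in two matrices at once:
  row counts see one of its two colours, column counts the other, and only the exponents of the
  Z-variables, which record both, tie them together inside a block. Heights are the least colours
  that increase strictly towards the south-east; a longest chain below \<open>x\<close>, extended by
  \<open>x\<close>, would be the diagonal of a forbidden minor if its height reached u_\<gamma>, so
  the u_\<gamma> colours 0, ..., u_\<gamma> - 1 suffice. The lexicographic order is used at the
  largest variable where two coloured monomials differ: the smaller monomial cannot have the larger
  exponent there, and consistency puts everything weakly north-west of that variable among the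
  larger variables, where both agree. It is uniqueness of the colouring, not a mere count of
  colourings, that keeps the coefficient alive in every characteristic.\<close>

definition chain_of :: "('a \<Rightarrow> 'a \<Rightarrow> bool) \<Rightarrow> 'a set \<Rightarrow> bool" where
  "chain_of R C \<longleftrightarrow> (\<forall>y\<in>C. \<forall>z\<in>C. y \<noteq> z \<longrightarrow> R y z \<or> R z y)"

text \<open>Only elements strictly below \<open>x\<close> are counted, so heights start at 0 and can
  serve directly as indices into \<open>{..<u}\<close>.\<close>

definition height :: "('a \<Rightarrow> 'a \<Rightarrow> bool) \<Rightarrow> 'a set \<Rightarrow> 'a \<Rightarrow> nat" where
  "height R S x = Max (card ` {C. C \<subseteq> S \<and> (\<forall>y\<in>C. R y x) \<and> chain_of R C})"

lemma height_ge_card: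
  assumes "finite S" "C \<subseteq> S" "\<And>y. y \<in> C \<Longrightarrow> R y x" "chain_of R C"
  shows "card C \<le> height R S x"
  unfolding height_def using assms by (intro Max_ge) auto

lemma height_chain:
  assumes "finite S"
  obtains C where "C \<subseteq> S" "\<And>y. y \<in> C \<Longrightarrow> R y x" "chain_of R C" "card C = height R S x"
proof -
  let ?X = "{C. C \<subseteq> S \<and> (\<forall>y\<in>C. R y x) \<and> chain_of R C}"
  have "{} \<in> ?X" by (simp add: chain_of_def)
  moreover have "finite ?X" using assms by auto
  ultimately have "Max (card ` ?X) \<in> card ` ?X" by (intro Max_in) auto
  then show ?thesis using that unfolding height_def by auto
qed

lemma height_mono:
  assumes "finite S" "\<And>y. y \<in> S \<Longrightarrow> R y x \<Longrightarrow> R y x'"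
  shows "height R S x \<le> height R S x'"
proof -
  obtain C where "C \<subseteq> S" "\<And>y. y \<in> C \<Longrightarrow> R y x" "chain_of R C" "card C = height R S x"
    using height_chain[OF assms(1)] by metis
  then show ?thesis using height_ge_card[OF assms(1), of C R x'] assms(2) by (metis subsetD)
qed

lemma height_less:
  assumes "finite S" "transp R" "irreflp R" "y \<in> S" "R y x"
  shows "height R S y < height R S x"
proof -
  obtain C where C: "C \<subseteq> S" "\<And>z. z \<in> C \<Longrightarrow> R z y" "chain_of R C" "card C = height R S y"
    using height_chain[OF assms(1)] by metis
  have "y \<notin> C" using C(2) assms(3) by (auto simp: irreflp_def)
  then have "card (insert y C) = Suc (height R S y)"
    using C(1,4) assms(1) by (simp add: finite_subset)
  moreover have "card (insert y C) \<le> height R S x"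
    using C assms unfolding chain_of_def by (intro height_ge_card) (blast dest: transpD | simp add: chain_of_def)+
  ultimately show ?thesis by simp
qed

text \<open>The topmost element of a longest chain below \<open>x\<close> works: the rest of the
  chain lies below it, so its height is at least one less than that of \<open>x\<close>, and it
  cannot be larger.\<close>

lemma height_pred:
  assumes "finite S" "transp R" "irreflp R" "height R S x > 0"
  obtains y where "y \<in> S" "R y x" "height R S x = Suc (height R S y)"
proof -
  obtain C where C: "C \<subseteq> S" "\<And>z. z \<in> C \<Longrightarrow> R z x" "chain_of R C" "card C = height R S x"
    using height_chain[OF assms(1)] by metis
  have fC: "finite C" "C \<noteq> {}" using C(1,4) assms(1,4) finite_subset by auto
  obtain y where y: "y \<in> C" "\<And>z. z \<in> C \<Longrightarrow> \<not> R y z"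
  proof -
    have tr: "transp_on C R" "asymp_on C R"
      using assms(2,3) by (auto simp: transp_on_def asymp_on_def irreflp_def dest: transpD)
    show ?thesis using Finite_Set.bex_max_element[OF fC(1) tr(2,1) fC(2)] that
      assms(3) by (metis irreflpD)
  qed
  have "card (C - {y}) \<le> height R S y"
    using C y assms(1) by (intro height_ge_card) (auto simp: chain_of_def)
  then have "height R S x \<le> Suc (height R S y)"
    using C(4) y(1) fC by simp
  moreover have "height R S y < height R S x"
    using height_less[OF assms(1-3)] C(1,2) y(1) by blast
  ultimately show ?thesis using that[of y] C(1,2) y(1) by fastforce
qed

text \<open>A longest chain below \<open>x\<close> together with \<open>x\<close> is a chain with
  one element more; it is cut down to exactly \<open>Suc n\<close> elements, the size of the minors
  in play. The side condition that all its elements are \<open>x\<close> or below \<open>x\<close>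
  later places the whole chain in a single matrix.\<close>

lemma height_bound:
  assumes "finite S" "transp R" "irreflp R" "x \<in> S"
    and no: "\<And>C. C \<subseteq> S \<Longrightarrow> chain_of R C \<Longrightarrow> \<forall>y\<in>C. y = x \<or> R y x \<Longrightarrow> card C \<noteq> Suc n"
  shows "height R S x < n"
proof (rule ccontr)
  assume a: "\<not> height R S x < n"
  obtain C where C: "C \<subseteq> S" "\<And>z. z \<in> C \<Longrightarrow> R z x" "chain_of R C" "card C = height R S x"
    using height_chain[OF assms(1)] by metis
  have "x \<notin> C" using C(2) assms(3) by (auto simp: irreflp_def)
  then have "card (insert x C) = Suc (height R S x)"
    using C(1,4) assms(1) by (simp add: finite_subset)
  then obtain D where D: "D \<subseteq> insert x C" "card D = Suc n"
    using a obtain_subset_with_card_n[of "Suc n" "insert x C"] by auto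
  have "chain_of R (insert x C)" using C by (auto simp: chain_of_def)
  then have "chain_of R D" using D(1) unfolding chain_of_def by blast
  moreover have "\<forall>y\<in>D. y = x \<or> R y x" using D(1) C(2) by blast
  ultimately show False using no[of D] D C(1) assms(4) by auto
qed

text \<open>The relation "strictly south-east" in a concatenated matrix. With \<open>f\<close> the
  row, \<open>g\<close> the column and \<open>v\<close> the target it refers to the sink matrix,
  where blocks stand side by side; with rows and columns exchanged and \<open>v\<close> the source,
  to the source matrix. Inside one block both instances are the same relation.\<close>

definition blk_less :: "('x \<Rightarrow> nat) \<Rightarrow> ('x \<Rightarrow> nat) \<Rightarrow> ('x \<Rightarrow> nat) \<Rightarrow> (nat \<Rightarrow> nat) \<Rightarrow> 'x \<Rightarrow> 'x \<Rightarrow> bool" where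
  "blk_less k f g v x y \<longleftrightarrow> v (k x) = v (k y) \<and> f x < f y \<and> (k x < k y \<or> k x = k y \<and> g x < g y)"

lemma transp_blk_less: "transp (blk_less k f g v)"
  by (auto simp: transp_def blk_less_def)

lemma irreflp_blk_less: "irreflp (blk_less k f g v)"
  by (auto simp: irreflp_def blk_less_def)

text \<open>For x weakly north-east of y in the same block, the two heights are compared in the same direction:
  along an antichain of constant first height the second height weakly increases to the north-east.\<close>

lemma height_swap:
  assumes S: "finite S"
    and "x \<in> S" "y \<in> S" "k x = k y" "f x \<le> f y" "g y \<le> g x"
    and "height (blk_less k f g v) S y \<le> height (blk_less k f g v) S x"
  shows "height (blk_less k g f w) S y \<le> height (blk_less k g f w) S x"
  using assms(2-)
proof (induction "height (blk_less k g f w) S y" arbitrary: x y)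
  case 0
  then show ?case by simp
next
  case (Suc n)
  let ?P = "blk_less k f g v" and ?Q = "blk_less k g f w"
  let ?p = "height ?P S" and ?q = "height ?Q S"
  note ltP = height_less[OF S transp_blk_less[of k f g v] irreflp_blk_less]
  note ltQ = height_less[OF S transp_blk_less[of k g f w] irreflp_blk_less]
  obtain y' where y': "y' \<in> S" "?Q y' y" "?q y = Suc (?q y')"
    using height_pred[OF S transp_blk_less irreflp_blk_less, of k g f w y] Suc.hyps(2) by auto
  show ?case
  proof (cases "?Q y' x")
    case True
    then show ?thesis using ltQ[OF y'(1)] y'(3) by fastforce
  next
    case False
    \<comment> \<open>A predecessor of \<open>y\<close> that fails to precede \<open>x\<close> must
      lie in the common block, with \<open>f x \<le> f y'\<close>. There both relations coincide, so
      \<open>y'\<close> precedes \<open>y\<close> for \<open>?P\<close> as well.\<close>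
    then have 1: "k y' = k y" "f y' < f y" "g y' < g y" "f x \<le> f y'"
      using y'(2) Suc.prems by (auto simp: blk_less_def)
    then have "?p y' < ?p y" using ltP[OF y'(1)] by (simp add: blk_less_def)
    then obtain z where z: "z \<in> S" "?P z x" "?p x = Suc (?p z)"
      using height_pred[OF S transp_blk_less irreflp_blk_less, of k f g v x] Suc.prems(6) by auto
    have 2: "?p y' \<le> ?p z" using z(3) \<open>?p y' < ?p y\<close> Suc.prems(6) by simp
    \<comment> \<open>Since \<open>f z < f x \<le> f y'\<close>, the only way for \<open>z\<close>
      not to be below \<open>y'\<close> is to be in the same block with
      \<open>g y' \<le> g z\<close>. So \<open>z\<close> and \<open>y'\<close> are placed like
      \<open>x\<close> and \<open>y\<close>, and the second height of \<open>y'\<close> is one less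
      than that of \<open>y\<close>.\<close>
    have "\<not> ?P z y'" using ltP[OF z(1)] 2 by fastforce
    then have 3: "k z = k y'" "f z \<le> f y'" "g y' \<le> g z" "?Q z x"
      using z(2) 1 Suc.prems by (auto simp: blk_less_def)
    have "?q y' \<le> ?q z"
      using Suc.hyps(1)[of y' z] Suc.hyps(2) y' z(1) 3 2 by auto
    then show ?thesis using ltQ[OF z(1) 3(4)] y'(3) by simp
  qed
qed

section \<open>Counting coloured variables by rows and blocks\<close>

lemma sum_eq_fibers:
  assumes E: "finite E" and eq: "\<And>t. sum B {e\<in>E. h e = t} = sum A {e\<in>E. h e = t}"
  shows "sum B {e\<in>E. F (h e)} = (sum A {e\<in>E. F (h e)} :: nat)"
proof -
  let ?S = "{e\<in>E. F (h e)}"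
  have f: "finite ?S" using E by simp
  have "sum B {e\<in>?S. h e = t} = sum A {e\<in>?S. h e = t}" if "t \<in> h ` ?S" for t
  proof -
    have "{e\<in>?S. h e = t} = {e\<in>E. h e = t}" using that by auto
    then show ?thesis using eq by simp
  qed
  then show ?thesis
    unfolding sum.image_gen[OF f, of B h] sum.image_gen[OF f, of A h] by simp
qed

text \<open>Over all blocks of one vertex, the rows up to \<open>i0\<close> with colours up to
  \<open>p0\<close> have the same total for A and B. Remove the earlier blocks, where A and B agree,
  and the part \<open>W\<close> beyond \<open>k0\<close> and \<open>q0\<close>. On \<open>W\<close>
  the total of B is at most that of A: without the row bound the totals are equal by the block
  counts, and by \<open>right\<close> the rows so added contain nothing of A.\<close>

lemma sum_rows_le:
  fixes A B :: "'e \<Rightarrow> nat" and k i p q :: "'e \<Rightarrow> nat" and v :: "nat \<Rightarrow> nat"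
  assumes E: "finite E"
    and row: "\<And>t. sum B {e\<in>E. (v (k e), i e, p e) = t} = sum A {e\<in>E. (v (k e), i e, p e) = t}"
    and blk: "\<And>t. sum B {e\<in>E. (k e, p e, q e) = t} = sum A {e\<in>E. (k e, p e, q e) = t}"
    and left: "\<And>e. e \<in> E \<Longrightarrow> v (k e) = v k0 \<Longrightarrow> k e < k0 \<Longrightarrow> i e \<le> i0 \<Longrightarrow> B e = A e"
    and right: "\<And>e. e \<in> E \<Longrightarrow> v (k e) = v k0 \<Longrightarrow> p e \<le> p0 \<Longrightarrow> k e > k0 \<or> k e = k0 \<and> q e > q0
        \<Longrightarrow> A e \<noteq> 0 \<Longrightarrow> i e \<le> i0"
  shows "sum A {e\<in>E. k e = k0 \<and> p e \<le> p0 \<and> q e \<le> q0 \<and> i e \<le> i0}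
       \<le> sum B {e\<in>E. k e = k0 \<and> p e \<le> p0 \<and> q e \<le> q0 \<and> i e \<le> i0}"
proof -
  define M where "M = {e\<in>E. k e = k0 \<and> p e \<le> p0 \<and> q e \<le> q0 \<and> i e \<le> i0}"
  define U where "U = {e\<in>E. v (k e) = v k0 \<and> i e \<le> i0 \<and> p e \<le> p0}"
  define L where "L = {e\<in>U. k e < k0}"
  define W' where "W' = {e\<in>E. v (k e) = v k0 \<and> p e \<le> p0 \<and> (k e > k0 \<or> k e = k0 \<and> q e > q0)}"
  define W where "W = {e\<in>W'. i e \<le> i0}"
  have fin: "finite M" "finite L" "finite W" "finite W'"
    using E by (auto simp: M_def L_def U_def W_def W'_def)
  have U: "U = L \<union> (M \<union> W)" "L \<inter> (M \<union> W) = {}" "M \<inter> W = {}"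
    by (auto simp: M_def L_def U_def W_def W'_def)
  have split: "sum X U = sum X L + (sum X M + sum X W)" for X :: "'e \<Rightarrow> nat"
    unfolding U(1) using fin U(2,3) by (simp add: sum.union_disjoint)
  have "sum B U = sum A U"
    using sum_eq_fibers[OF E row, of "\<lambda>(a, b, c). a = v k0 \<and> b \<le> i0 \<and> c \<le> p0"] by (simp add: U_def)
  moreover have "sum B L = sum A L"
    by (rule sum.cong) (auto simp: L_def U_def intro: left)
  moreover have "sum B W \<le> sum A W"
  proof -
    have "sum B W \<le> sum B W'" using fin by (intro sum_mono2) (auto simp: W_def)
    also have "\<dots> = sum A W'"
      using sum_eq_fibers[OF E blk, of "\<lambda>(a, b, c). v a = v k0 \<and> b \<le> p0 \<and> (a > k0 \<or> a = k0 \<and> c > q0)"]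
      by (simp add: W'_def)
    also have "\<dots> = sum A W"
      using fin by (intro sum.mono_neutral_right) (auto simp: W_def W'_def dest: right)
    finally show ?thesis .
  qed
  ultimately have "sum A M \<le> sum B M" using split[of A] split[of B] by linarith
  then show ?thesis by (simp add: M_def)
qed

text \<open>A and B have equal totals on the row fibre of \<open>e0\<close>. B already reaches this
  total on the support of A, which avoids \<open>e0\<close>, so nothing is left for
  \<open>e0\<close>.\<close>

lemma no_smaller_color:
  fixes A B :: "'e \<Rightarrow> nat"
  assumes E: "finite E"
    and row: "\<And>t. sum B {e\<in>E. (v (k e), i e, p e) = t} = sum A {e\<in>E. (v (k e), i e, p e) = t}"
    and e0: "e0 \<in> E"
    and eqA: "\<And>e. e \<in> E \<Longrightarrow> v (k e) = v (k e0) \<Longrightarrow> i e = i e0 \<Longrightarrow> p e = p e0 \<Longrightarrow> A e \<noteq> 0 \<Longrightarrow>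
        B e = A e \<and> e \<noteq> e0"
  shows "B e0 = 0"
proof -
  let ?R = "{e\<in>E. (v (k e), i e, p e) = (v (k e0), i e0, p e0)}"
  let ?L = "{e\<in>?R. A e \<noteq> 0}"
  have "sum B ?R = sum A ?R" by (rule row)
  also have "\<dots> = sum A ?L" using E by (intro sum.mono_neutral_right) auto
  also have "\<dots> = sum B ?L" by (rule sum.cong) (auto dest: eqA)
  finally have "sum B ?R = sum B ?L" .
  moreover have "e0 \<notin> ?L" "insert e0 ?L \<subseteq> ?R" using e0 eqA[of e0] by auto
  moreover have "sum B (insert e0 ?L) \<le> sum B ?R" using E \<open>insert e0 ?L \<subseteq> ?R\<close> by (intro sum_mono2) auto
  ultimately show ?thesis using E by simp
qed

section \<open>Rigidity of the height colouring\<close>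

abbreviation row_ix :: "qvar \<Rightarrow> nat" where "row_ix x \<equiv> fst (snd x)"
abbreviation col_ix :: "qvar \<Rightarrow> nat" where "col_ix x \<equiv> snd (snd x)"

text \<open>Here A counts the coloured variables of the height colouring and B those of a competitor with the same
  image under the parametrization; x0 is the largest variable at which they differ. Inside the block of x0 one
  counts the elements whose two colours are at most those of x0: the colouring A has none strictly
  south-east of x0, and inclusion-exclusion over the rows above and the columns left of x0 would leave B a
  negative number of them.\<close>

lemma coloring_rigid:
  fixes A B :: "qvar \<times> nat \<times> nat \<Rightarrow> nat" and tgt src :: "nat \<Rightarrow> nat"
  defines "P \<equiv> blk_less fst row_ix col_ix tgt" and "Q \<equiv> blk_less fst col_ix row_ix src"
  assumes E: "finite E" and S: "finite S"
    and A: "\<And>x p q. (x, p, q) \<in> E \<Longrightarrow> A (x, p, q) \<noteq> 0 \<Longrightarrow> x \<in> S \<and> p = height P S x \<and> q = height Q S x"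
    and rows: "\<And>t. sum B {e\<in>E. (tgt (fst (fst e)), row_ix (fst e), fst (snd e)) = t}
                 = sum A {e\<in>E. (tgt (fst (fst e)), row_ix (fst e), fst (snd e)) = t}"
    and cols: "\<And>t. sum B {e\<in>E. (src (fst (fst e)), col_ix (fst e), snd (snd e)) = t}
                 = sum A {e\<in>E. (src (fst (fst e)), col_ix (fst e), snd (snd e)) = t}"
    and blk: "\<And>t. sum B {e\<in>E. (fst (fst e), fst (snd e), snd (snd e)) = t}
                 = sum A {e\<in>E. (fst (fst e), fst (snd e), snd (snd e)) = t}"
    and agreeP: "\<And>x p q. (x, p, q) \<in> E \<Longrightarrow> tgt (fst x) = tgt (fst x0) \<Longrightarrow> row_ix x \<le> row_ix x0 \<Longrightarrow>
        fst x < fst x0 \<or> fst x = fst x0 \<and> col_ix x \<le> col_ix x0 \<Longrightarrow> x \<noteq> x0 \<Longrightarrow> B (x, p, q) = A (x, p, q)"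
    and agreeQ: "\<And>x p q. (x, p, q) \<in> E \<Longrightarrow> src (fst x) = src (fst x0) \<Longrightarrow> col_ix x \<le> col_ix x0 \<Longrightarrow>
        fst x < fst x0 \<or> fst x = fst x0 \<and> row_ix x \<le> row_ix x0 \<Longrightarrow> x \<noteq> x0 \<Longrightarrow> B (x, p, q) = A (x, p, q)"
    and x0: "x0 \<in> S" "(x0, height P S x0, height Q S x0) \<in> E"
  shows "A (x0, height P S x0, height Q S x0) \<le> B (x0, height P S x0, height Q S x0)"
proof (rule ccontr)
  assume less: "\<not> ?thesis"
  define cp where "cp = height P S"
  define cq where "cq = height Q S"
  define k0 where "k0 = fst x0"
  note ltP = height_less[OF S transp_blk_less irreflp_blk_less, of _ fst row_ix col_ix tgt, folded P_def cp_def]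
  note ltQ = height_less[OF S transp_blk_less irreflp_blk_less, of _ fst col_ix row_ix src, folded Q_def cq_def]
  note A' = A[folded cp_def cq_def]
  \<comment> \<open>Block counts with the two colours exchanged, for the transposed argument on
    columns.\<close>
  have blk': "sum B {e\<in>E. (fst (fst e), snd (snd e), fst (snd e)) = t}
           = sum A {e\<in>E. (fst (fst e), snd (snd e), fst (snd e)) = t}" for t
    using sum_eq_fibers[OF E blk, of "\<lambda>s. (fst s, snd (snd s), fst (snd s)) = t"] by simp
  \<comment> \<open>Here \<open>x\<close> lies weakly south-west of \<open>x0\<close> in the block,
    in \<open>swapQ\<close> weakly north-east; the second fact is the transposed instance of
    \<open>height_swap\<close>.\<close>
  have swapP: "cq x \<le> cq x0" if "x \<in> S" "fst x = k0" "row_ix x0 \<le> row_ix x" "col_ix x \<le> col_ix x0" "cp x \<le> cp x0" for x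
    using height_swap[OF S x0(1) that(1), of fst row_ix col_ix tgt src] that
    by (simp add: cp_def cq_def P_def Q_def k0_def)
  have swapQ: "cp x \<le> cp x0" if "x \<in> S" "fst x = k0" "col_ix x0 \<le> col_ix x" "row_ix x \<le> row_ix x0" "cq x \<le> cq x0" for x
    using height_swap[OF S x0(1) that(1), of fst col_ix row_ix src tgt] that
    by (simp add: cp_def cq_def P_def Q_def k0_def)
  define T where "T = {e\<in>E. fst (fst e) = k0 \<and> fst (snd e) \<le> cp x0 \<and> snd (snd e) \<le> cq x0}"
  define Rm where "Rm = {e\<in>T. row_ix (fst e) \<le> row_ix x0}"
  define Cm where "Cm = {e\<in>T. col_ix (fst e) \<le> col_ix x0}"
  have fin: "finite T" "finite Rm" "finite Cm" using E by (auto simp: T_def Rm_def Cm_def)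
  have T: "sum B T = sum A T"
    using sum_eq_fibers[OF E blk, of "\<lambda>s. fst s = k0 \<and> fst (snd s) \<le> cp x0 \<and> snd (snd s) \<le> cq x0"] by (simp add: T_def)
  have Rm: "sum A Rm \<le> sum B Rm"
  proof -
    have eq: "Rm = {e\<in>E. fst (fst e) = k0 \<and> fst (snd e) \<le> cp x0 \<and> snd (snd e) \<le> cq x0 \<and> row_ix (fst e) \<le> row_ix x0}"
      by (auto simp: Rm_def T_def)
    show ?thesis unfolding eq
    proof (rule sum_rows_le[where A=A and B=B and k="\<lambda>e. fst (fst e)" and i="\<lambda>e. row_ix (fst e)" and p="\<lambda>e. fst (snd e)" and v=tgt and q="\<lambda>e. snd (snd e)", OF E rows blk])
      fix e assume "e \<in> E" "tgt (fst (fst e)) = tgt k0" "fst (fst e) < k0" "row_ix (fst e) \<le> row_ix x0"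
      then show "B e = A e" using agreeP[of "fst e" "fst (snd e)" "snd (snd e)"] by (auto simp: k0_def)
    next
      fix e assume e: "e \<in> E" "tgt (fst (fst e)) = tgt k0" "fst (snd e) \<le> cp x0"
        "k0 < fst (fst e) \<or> fst (fst e) = k0 \<and> cq x0 < snd (snd e)" "A e \<noteq> 0"
      define x where "x = fst e"
      have x: "x \<in> S" "fst (snd e) = cp x" "snd (snd e) = cq x"
        using A'[of x "fst (snd e)" "snd (snd e)"] e by (auto simp: x_def)
      show "row_ix (fst e) \<le> row_ix x0"
      proof (rule ccontr)
        assume n: "\<not> row_ix (fst e) \<le> row_ix x0"
        \<comment> \<open>Otherwise the first colour of \<open>x\<close> would exceed
          \<open>cp x0\<close>. Being below the row of \<open>x0\<close> and not in an earlier
          block, \<open>x\<close> must then be in the block of \<open>x0\<close> and weakly left of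
          it, where \<open>swapP\<close> contradicts its large second colour.\<close>
        have "\<not> P x0 x" using ltP[OF x0(1), of x] e x by fastforce
        then have "fst x = k0" "col_ix x \<le> col_ix x0" using n e(2,4) by (auto simp: P_def blk_less_def k0_def x_def)
        then show False using swapP[OF x(1)] n e x by (auto simp: x_def)
      qed
    qed
  qed
  have Cm: "sum A Cm \<le> sum B Cm"
  proof -
    have eq: "Cm = {e\<in>E. fst (fst e) = k0 \<and> snd (snd e) \<le> cq x0 \<and> fst (snd e) \<le> cp x0 \<and> col_ix (fst e) \<le> col_ix x0}"
      by (auto simp: Cm_def T_def)
    show ?thesis unfolding eq
    proof (rule sum_rows_le[where A=A and B=B and k="\<lambda>e. fst (fst e)" and i="\<lambda>e. col_ix (fst e)" and p="\<lambda>e. snd (snd e)" and v=src and q="\<lambda>e. fst (snd e)", OF E cols blk'])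
      fix e assume "e \<in> E" "src (fst (fst e)) = src k0" "fst (fst e) < k0" "col_ix (fst e) \<le> col_ix x0"
      then show "B e = A e" using agreeQ[of "fst e" "fst (snd e)" "snd (snd e)"] by (auto simp: k0_def)
    next
      fix e assume e: "e \<in> E" "src (fst (fst e)) = src k0" "snd (snd e) \<le> cq x0"
        "k0 < fst (fst e) \<or> fst (fst e) = k0 \<and> cp x0 < fst (snd e)" "A e \<noteq> 0"
      define x where "x = fst e"
      have x: "x \<in> S" "fst (snd e) = cp x" "snd (snd e) = cq x"
        using A'[of x "fst (snd e)" "snd (snd e)"] e by (auto simp: x_def)
      show "col_ix (fst e) \<le> col_ix x0"
      proof (rule ccontr)
        assume n: "\<not> col_ix (fst e) \<le> col_ix x0"
        have "\<not> Q x0 x" using ltQ[OF x0(1), of x] e x by fastforce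
        then have "fst x = k0" "row_ix x \<le> row_ix x0" using n e(2,4) by (auto simp: Q_def blk_less_def k0_def x_def)
        then show False using swapQ[OF x(1)] n e x by (auto simp: x_def)
      qed
    qed
  qed
  \<comment> \<open>Heights weakly increase from left to right along a row of the sink matrix. Hence
    the variables in the row of \<open>x0\<close> to which A gives a colour below
    \<open>cp x0\<close> all lie to the left of \<open>x0\<close>, where A and B agree, and they
    exhaust the row count of that colour.\<close>
  have smallP: "B (x0, p, q) = 0" if "(x0, p, q) \<in> E" "p < cp x0" for p q
  proof (rule no_smaller_color[where A=A and B=B and k="\<lambda>e. fst (fst e)" and i="\<lambda>e. row_ix (fst e)" and p="\<lambda>e. fst (snd e)" and v=tgt, OF E rows that(1)])
    fix e assume e: "e \<in> E" "tgt (fst (fst e)) = tgt (fst (fst (x0, p, q)))" "row_ix (fst e) = row_ix (fst (x0, p, q))"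
      "fst (snd e) = fst (snd (x0, p, q))" "A e \<noteq> 0"
    define x where "x = fst e"
    have x: "x \<in> S" "p = cp x"
      using A'[of x "fst (snd e)" "snd (snd e)"] e by (auto simp: x_def)
    have "fst x < fst x0 \<or> fst x = fst x0 \<and> col_ix x \<le> col_ix x0"
    proof (rule ccontr)
      assume "\<not> ?thesis"
      then have "cp x0 \<le> cp x" unfolding cp_def using e(2,3)
        by (intro height_mono[OF S]) (auto simp: P_def blk_less_def x_def)
      then show False using x that by simp
    qed
    moreover have "x \<noteq> x0" using x that by auto
    ultimately show "B e = A e \<and> e \<noteq> (x0, p, q)"
      using agreeP[of x "fst (snd e)" "snd (snd e)"] e by (cases e) (auto simp: x_def)
  qed
  have smallQ: "B (x0, p, q) = 0" if "(x0, p, q) \<in> E" "q < cq x0" for p q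
  proof (rule no_smaller_color[where A=A and B=B and k="\<lambda>e. fst (fst e)" and i="\<lambda>e. col_ix (fst e)" and p="\<lambda>e. snd (snd e)" and v=src, OF E cols that(1)])
    fix e assume e: "e \<in> E" "src (fst (fst e)) = src (fst (fst (x0, p, q)))" "col_ix (fst e) = col_ix (fst (x0, p, q))"
      "snd (snd e) = snd (snd (x0, p, q))" "A e \<noteq> 0"
    define x where "x = fst e"
    have x: "x \<in> S" "q = cq x"
      using A'[of x "fst (snd e)" "snd (snd e)"] e by (auto simp: x_def)
    have "fst x < fst x0 \<or> fst x = fst x0 \<and> row_ix x \<le> row_ix x0"
    proof (rule ccontr)
      assume "\<not> ?thesis"
      then have "cq x0 \<le> cq x" unfolding cq_def using e(2,3)
        by (intro height_mono[OF S]) (auto simp: Q_def blk_less_def x_def)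
      then show False using x that by simp
    qed
    moreover have "x \<noteq> x0" using x that by auto
    ultimately show "B e = A e \<and> e \<noteq> (x0, p, q)"
      using agreeQ[of x "fst (snd e)" "snd (snd e)"] e by (cases e) (auto simp: x_def)
  qed
  let ?e0 = "(x0, cp x0, cq x0)"
  \<comment> \<open>\<open>Rm \<inter> Cm\<close> consists of coloured variables weakly north-west
    of \<open>x0\<close> in its block. Away from \<open>x0\<close> both counts agree there; at
    \<open>x0\<close> B vanishes on every other colour pair in range, and on the height pair it
    falls short of A by assumption.\<close>
  have N: "sum B (Rm \<inter> Cm) < sum A (Rm \<inter> Cm)"
  proof (rule sum_strict_mono_ex1)
    show "finite (Rm \<inter> Cm)" using fin by simp
    have e0: "?e0 \<in> Rm \<inter> Cm" using x0 by (simp add: Rm_def Cm_def T_def cp_def cq_def k0_def)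
    moreover have l: "B ?e0 < A ?e0" using less by (simp add: cp_def cq_def)
    ultimately show "\<exists>e\<in>Rm \<inter> Cm. B e < A e" by blast
    show "\<forall>e\<in>Rm \<inter> Cm. B e \<le> A e"
    proof
      fix e assume "e \<in> Rm \<inter> Cm"
      then have e: "e \<in> E" "fst (fst e) = k0" "fst (snd e) \<le> cp x0" "snd (snd e) \<le> cq x0"
        "row_ix (fst e) \<le> row_ix x0" "col_ix (fst e) \<le> col_ix x0"
        by (auto simp: Rm_def Cm_def T_def)
      obtain x p q where epq: "e = (x, p, q)" by (cases e) auto
      show "B e \<le> A e"
      proof (cases "x = x0")
        case False
        then show ?thesis using agreeP[of x p q] e epq by (simp add: k0_def)
      next
        case True
        then show ?thesis using smallP[of p q] smallQ[of p q] e epq l by fastforce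
      qed
    qed
  qed
  have "sum A (Rm \<union> Cm) = sum A T"
  proof (rule sum.mono_neutral_left)
    show "Rm \<union> Cm \<subseteq> T" by (auto simp: Rm_def Cm_def)
    show "\<forall>e\<in>T - (Rm \<union> Cm). A e = 0"
    proof (rule ballI, rule ccontr)
      fix e assume e: "e \<in> T - (Rm \<union> Cm)" "A e \<noteq> 0"
      obtain x p q where epq: "e = (x, p, q)" by (cases e) auto
      \<comment> \<open>Outside both strips means strictly south-east of \<open>x0\<close>, where
        the height exceeds the bound \<open>cp x0\<close> imposed in \<open>T\<close>.\<close>
      have "P x0 x" using e epq by (auto simp: P_def blk_less_def T_def Rm_def Cm_def k0_def)
      then show False using A'[of x p q] ltP[OF x0(1), of x] e epq by (auto simp: T_def)
    qed
  qed (rule fin)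
  moreover have "sum B (Rm \<union> Cm) \<le> sum B T"
    using fin by (intro sum_mono2) (auto simp: Rm_def Cm_def)
  moreover have inex: "sum X (Rm \<union> Cm) + sum X (Rm \<inter> Cm) = sum X Rm + sum X Cm" for X :: "_ \<Rightarrow> nat"
    using fin by (simp add: sum.union_inter)
  note inex[of A] inex[of B]
  \<comment> \<open>Writing X(M) for \<open>sum X M\<close>: A(T) = A(Rm) + A(Cm) - A(Rm \<inter>
    Cm) < B(Rm) + B(Cm) - B(Rm \<inter> Cm) = B(Rm \<union> Cm) \<le> B(T) = A(T).\<close>
  ultimately show False using T Rm Cm N by linarith
qed

section \<open>Substitution of polynomials and leading monomials\<close>

lemma prod_single:
  "finite I \<Longrightarrow> (\<Prod>i\<in>I. Poly_Mapping.single (f i) (1::'a::comm_semiring_1)) = Poly_Mapping.single (\<Sum>i\<in>I. f i) 1"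
  by (induction I rule: finite_induct) (simp_all add: mult_single)

text \<open>The product ranges over one fixed set \<open>V\<close> for all monomials, so variables
  outside \<open>V\<close> are sent to 1 and multiplicativity reduces to additivity of
  exponents.\<close>

definition subst_poly :: "'x set \<Rightarrow> ('x \<Rightarrow> 'y \<Rightarrow>\<^sub>0 'a) \<Rightarrow> (('x \<Rightarrow>\<^sub>0 nat) \<Rightarrow>\<^sub>0 'a)
    \<Rightarrow> ('y::comm_monoid_add \<Rightarrow>\<^sub>0 'a::comm_ring_1)" where
  "subst_poly V \<theta> f = (\<Sum>m\<in>Poly_Mapping.keys f. Poly_Mapping.single 0 (Poly_Mapping.lookup f m) *
     (\<Prod>x\<in>V. \<theta> x ^ Poly_Mapping.lookup m x))"

lemma subst_poly_superset:
  assumes "finite X" "Poly_Mapping.keys f \<subseteq> X"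
  shows "subst_poly V \<theta> f = (\<Sum>m\<in>X. Poly_Mapping.single 0 (Poly_Mapping.lookup f m) *
     (\<Prod>x\<in>V. \<theta> x ^ Poly_Mapping.lookup m x))"
  unfolding subst_poly_def using assms
  by (intro sum.mono_neutral_left) (auto simp: in_keys_iff)

lemma subst_poly_add: "subst_poly V \<theta> (f + g) = subst_poly V \<theta> f + subst_poly V \<theta> g"
proof -
  let ?X = "Poly_Mapping.keys f \<union> Poly_Mapping.keys g"
  have "finite ?X" "Poly_Mapping.keys (f + g) \<subseteq> ?X" by (simp_all add: Poly_Mapping.keys_add)
  then show ?thesis
    by (simp add: subst_poly_superset[of ?X] lookup_add single_add distrib_right sum.distrib)
qed

lemma subst_poly_0 [simp]: "subst_poly V \<theta> 0 = 0"
  by (simp add: subst_poly_def)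

lemma subst_poly_single:
  "subst_poly V \<theta> (Poly_Mapping.single m c) = Poly_Mapping.single 0 c * (\<Prod>x\<in>V. \<theta> x ^ Poly_Mapping.lookup m x)"
  by (simp add: subst_poly_superset[of "{m}"])

lemma subst_poly_1 [simp]: "subst_poly V \<theta> 1 = 1"
  using subst_poly_single[of V \<theta> 0 1] by simp

lemma subst_poly_sum: "subst_poly V \<theta> (\<Sum>i\<in>I. f i) = (\<Sum>i\<in>I. subst_poly V \<theta> (f i))"
  by (induction I rule: infinite_finite_induct) (simp_all add: subst_poly_add)

lemma poly_mapping_sum_single:
  "f = (\<Sum>m\<in>Poly_Mapping.keys f. Poly_Mapping.single m (Poly_Mapping.lookup f m))"
  by (rule poly_mapping_eqI) (auto simp: lookup_sum lookup_single when_def in_keys_iff if_distrib cong: if_cong)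

lemma subst_poly_mult:
  fixes \<theta> :: "'x \<Rightarrow> 'y::comm_monoid_add \<Rightarrow>\<^sub>0 'a::comm_ring_1"
  shows "subst_poly V \<theta> (f * g) = subst_poly V \<theta> f * subst_poly V \<theta> g"
proof -
  have *: "subst_poly V \<theta> (Poly_Mapping.single m c * Poly_Mapping.single m' c')
      = subst_poly V \<theta> (Poly_Mapping.single m c) * subst_poly V \<theta> (Poly_Mapping.single m' c')" for m c m' c'
  proof -
    have e: "Poly_Mapping.single (0::'y) (c * c') = Poly_Mapping.single 0 c * Poly_Mapping.single 0 c'"
      by (simp add: mult_single)
    show ?thesis
      unfolding mult_single subst_poly_single lookup_add power_add prod.distrib
      unfolding e by (simp only: mult_ac)
  qed
  define F where "F m = Poly_Mapping.single m (Poly_Mapping.lookup f m)" for m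
  define G where "G m = Poly_Mapping.single m (Poly_Mapping.lookup g m)" for m
  have FG: "f = sum F (Poly_Mapping.keys f)" "g = sum G (Poly_Mapping.keys g)"
    unfolding F_def G_def by (rule poly_mapping_sum_single)+
  have "subst_poly V \<theta> (sum F X * sum G Y) = subst_poly V \<theta> (sum F X) * subst_poly V \<theta> (sum G Y)" for X Y
    unfolding sum_product subst_poly_sum by (simp only: F_def G_def *)
  then show ?thesis using FG by metis
qed

lemma subst_poly_prod: "subst_poly V \<theta> (\<Prod>i\<in>I. f i) = (\<Prod>i\<in>I. subst_poly V \<theta> (f i))"
  by (induction I rule: infinite_finite_induct) (simp_all add: subst_poly_mult)

lemma subst_poly_uminus: "subst_poly V \<theta> (- f) = - subst_poly V \<theta> f"
  using subst_poly_add[of V \<theta> f "- f"] by (simp add: eq_neg_iff_add_eq_0 add.commute)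

lemma subst_poly_sign: "subst_poly V \<theta> (of_int (sign p)) = of_int (sign p)"
  by (simp add: sign_def subst_poly_uminus)

lemma subst_poly_Var:
  assumes "finite V" "x \<in> V"
  shows "subst_poly V \<theta> (Var x) = \<theta> x"
proof -
  have "(\<Prod>y\<in>V. \<theta> y ^ Poly_Mapping.lookup (Poly_Mapping.single x 1) y) = (\<Prod>y\<in>V. if y = x then \<theta> y else 1)"
    by (intro prod.cong) (auto simp: lookup_single when_def)
  then show ?thesis using assms by (simp add: Var_def subst_poly_single)
qed

text \<open>Padding both factors with zeros to square matrices turns the low inner dimension into a
  zero column of the left factor: column \<open>n - 1\<close> is zero because \<open>u < n\<close>,
  and every permutation picks an entry from it. Multiplicativity of the determinant does the
  rest.\<close>

lemma leibniz_low_rank: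
  fixes W :: "nat \<Rightarrow> nat \<Rightarrow> 'b::comm_ring_1"
  assumes W: "\<And>i j. i < n \<Longrightarrow> j < n \<Longrightarrow> W i j = (\<Sum>s<u. F i s * G s j)" and "u < n"
  shows "(\<Sum>p\<in>{p. p permutes {..<n}}. of_int (sign p) * (\<Prod>l<n. W l (p l))) = 0"
proof -
  define MF where "MF = Matrix.mat n n (\<lambda>(i, s). if s < u then F i s else 0)"
  define MG where "MG = Matrix.mat n n (\<lambda>(s, j). if s < u then G s j else 0)"
  have car: "MF \<in> carrier_mat n n" "MG \<in> carrier_mat n n" by (auto simp: MF_def MG_def)
  have "(\<Prod>i = 0..<n. MF $$ (i, p i)) = 0" if p: "p permutes {0..<n}" for p
  proof -
    obtain i where i: "p i = n - 1" using permutes_surj[OF p] by (metis surjD)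
    have "i < n" using permutes_in_image[OF p, of i] i \<open>u < n\<close> by auto
    then have "MF $$ (i, p i) = 0" using i \<open>u < n\<close> by (simp add: MF_def)
    then show ?thesis using \<open>i < n\<close> by (intro prod_zero) auto
  qed
  then have 0: "det MF = 0" unfolding det_def'[OF car(1)] by simp
  have "(MF * MG) $$ (i, j) = W i j" if "i < n" "j < n" for i j
  proof -
    have "(MF * MG) $$ (i, j) = (\<Sum>s = 0..<n. (if s < u then F i s else 0) * (if s < u then G s j else 0))"
      using that by (simp add: MF_def MG_def scalar_prod_def)
    also have "\<dots> = (\<Sum>s<u. F i s * G s j)"
      using \<open>u < n\<close> by (intro sum.mono_neutral_cong_right) auto
    finally show ?thesis using W that by simp
  qed
  moreover have "det (MF * MG) = 0" using det_mult[OF car] 0 by simp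
  moreover have "MF * MG \<in> carrier_mat n n" using car by simp
  ultimately have "(\<Sum>p\<in>{p. p permutes {0..<n}}. of_int (sign p) * (\<Prod>l = 0..<n. W l (p l))) = 0"
    unfolding det_def'[OF \<open>MF * MG \<in> carrier_mat n n\<close>]
    by (subst (asm) sum.cong[OF refl, where h = "\<lambda>p. of_int (sign p) * (\<Prod>l = 0..<n. W l (p l))"])
      (auto intro!: prod.cong simp: permutes_in_image)
  then show ?thesis by (simp only: atLeast0LessThan)
qed

text \<open>Expanding the powers chooses a colour for each of the \<open>b x\<close> labelled copies
  of each \<open>x\<close>. Every choice contributes coefficient 1, so the coefficient of \<mu> is
  the number of choices of total weight \<mu>, read in the coefficient ring.\<close>

lemma lookup_prod_sum_single:
  assumes "finite V" "\<And>x. x \<in> V \<Longrightarrow> finite (Cl x)"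
  shows "Poly_Mapping.lookup (\<Prod>x\<in>V. (\<Sum>c\<in>Cl x. Poly_Mapping.single (w x c) (1::'a::comm_ring_1)) ^ b x) \<mu>
    = of_nat (card {cs \<in> PiE (SIGMA x:V. {..<b x}) (\<lambda>i. Cl (fst i)).
        (\<Sum>i\<in>(SIGMA x:V. {..<b x}). w (fst i) (cs i)) = \<mu>})"
proof -
  let ?I = "SIGMA x:V. {..<b x}"
  let ?P = "PiE ?I (\<lambda>i. Cl (fst i))"
  have fI: "finite ?I" using assms by auto
  have fP: "finite ?P" using assms fI by (intro finite_PiE) auto
  have "(\<Prod>x\<in>V. (\<Sum>c\<in>Cl x. Poly_Mapping.single (w x c) (1::'a)) ^ b x)
      = (\<Prod>x\<in>V. \<Prod>t<b x. \<Sum>c\<in>Cl x. Poly_Mapping.single (w x c) 1)" by simp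
  also have "\<dots> = (\<Prod>i\<in>?I. \<Sum>c\<in>Cl (fst i). Poly_Mapping.single (w (fst i) c) 1)"
    using assms by (subst prod.Sigma) (auto simp: case_prod_beta)
  also have "\<dots> = (\<Sum>cs\<in>?P. \<Prod>i\<in>?I. Poly_Mapping.single (w (fst i) (cs i)) 1)"
    using assms fI by (intro prod_sum_PiE) auto
  also have "\<dots> = (\<Sum>cs\<in>?P. Poly_Mapping.single (\<Sum>i\<in>?I. w (fst i) (cs i)) 1)"
    by (simp only: prod_single[OF fI])
  finally show ?thesis
    using fP by (simp add: lookup_sum lookup_single when_def sum.If_cases Int_def)
qed

section \<open>The lexicographic order and its leading monomials\<close>

lemma strict_total_max:
  assumes "strict_total_on V gt" "finite D" "D \<noteq> {}" "D \<subseteq> V"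
  obtains x where "x \<in> D" "\<And>y. y \<in> D \<Longrightarrow> y \<noteq> x \<Longrightarrow> gt x y"
proof -
  have "\<exists>x\<in>D. \<forall>y\<in>D. y \<noteq> x \<longrightarrow> gt x y"
    using assms(2-4)
  proof (induction D rule: finite_ne_induct)
    case (insert a D)
    then obtain x where x: "x \<in> D" "\<forall>y\<in>D. y \<noteq> x \<longrightarrow> gt x y" by auto
    have in_V: "a \<in> V" "x \<in> V" "D \<subseteq> V" "a \<noteq> x" using insert.prems insert.hyps x by auto
    have tr: "gt p s" if "p \<in> V" "q \<in> V" "s \<in> V" "gt p q" "gt q s" for p q s
      using assms(1) that unfolding strict_total_on_def by blast
    have "gt a x \<or> gt x a" using assms(1) in_V unfolding strict_total_on_def by blast
    then show ?case
    proof
      assume "gt a x"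
      then have "gt a y" if "y \<in> D" for y
        using tr[of a x y] that x in_V by (cases "y = x") auto
      then show ?thesis by auto
    qed (use x in auto)
  qed simp
  then show ?thesis using that by blast
qed

lemma strict_total_asym: "strict_total_on V gt \<Longrightarrow> x \<in> V \<Longrightarrow> y \<in> V \<Longrightarrow> gt x y \<Longrightarrow> \<not> gt y x"
  unfolding strict_total_on_def by blast

lemma lex_gt_asym:
  assumes V: "strict_total_on V gt" and ab: "lex_gt gt V a b"
  shows "\<not> lex_gt gt V b a"
proof
  assume "lex_gt gt V b a"
  then obtain y where y: "y \<in> V" "Poly_Mapping.lookup b y > Poly_Mapping.lookup a y"
    "\<And>z. z \<in> V \<Longrightarrow> gt z y \<Longrightarrow> Poly_Mapping.lookup b z = Poly_Mapping.lookup a z"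
    unfolding lex_gt_def by blast
  obtain x where x: "x \<in> V" "Poly_Mapping.lookup a x > Poly_Mapping.lookup b x"
    "\<And>z. z \<in> V \<Longrightarrow> gt z x \<Longrightarrow> Poly_Mapping.lookup a z = Poly_Mapping.lookup b z"
    using ab unfolding lex_gt_def by blast
  have "x \<noteq> y" using x y by auto
  then have "gt x y \<or> gt y x" using V x y unfolding strict_total_on_def by blast
  then show False using x y by fastforce
qed

lemma lex_gt_trans:
  assumes V: "strict_total_on V gt" and ab: "lex_gt gt V a b" and bc: "lex_gt gt V b c"
  shows "lex_gt gt V a c"
proof -
  let ?l = Poly_Mapping.lookup
  obtain y where y: "y \<in> V" "?l b y > ?l c y" "\<And>z. z \<in> V \<Longrightarrow> gt z y \<Longrightarrow> ?l b z = ?l c z"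
    using bc unfolding lex_gt_def by blast
  obtain x where x: "x \<in> V" "?l a x > ?l b x" "\<And>z. z \<in> V \<Longrightarrow> gt z x \<Longrightarrow> ?l a z = ?l b z"
    using ab unfolding lex_gt_def by blast
  have tr: "\<And>p q r. p \<in> V \<Longrightarrow> q \<in> V \<Longrightarrow> r \<in> V \<Longrightarrow> gt p q \<Longrightarrow> gt q r \<Longrightarrow> gt p r"
    using V unfolding strict_total_on_def by blast
  consider "x = y" | "gt x y" | "gt y x" using V x y unfolding strict_total_on_def by blast
  then show ?thesis
  proof cases
    case 1
    then show ?thesis unfolding lex_gt_def using x y by (intro bexI[of _ x]) auto
  next
    case 2
    then have "?l b x = ?l c x" "\<And>z. z \<in> V \<Longrightarrow> gt z x \<Longrightarrow> ?l b z = ?l c z"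
      using x y tr by blast+
    then show ?thesis unfolding lex_gt_def using x by (intro bexI[of _ x]) auto
  next
    case 3
    then have "?l a y = ?l b y" "\<And>z. z \<in> V \<Longrightarrow> gt z y \<Longrightarrow> ?l a z = ?l b z"
      using x y tr by blast+
    then show ?thesis unfolding lex_gt_def using y by (intro bexI[of _ y]) auto
  qed
qed

lemma lex_gt_total:
  assumes V: "strict_total_on V gt" "finite V"
    and ab: "Poly_Mapping.keys a \<subseteq> V" "Poly_Mapping.keys b \<subseteq> V" "a \<noteq> b"
  shows "lex_gt gt V a b \<or> lex_gt gt V b a"
proof -
  let ?l = Poly_Mapping.lookup
  let ?D = "{x\<in>V. ?l a x \<noteq> ?l b x}"
  have "?D \<noteq> {}"
  proof
    assume e: "?D = {}"
    have "?l a x = ?l b x" for x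
    proof (cases "x \<in> V")
      case True then show ?thesis using e by blast
    next
      case False
      then have "x \<notin> Poly_Mapping.keys a" "x \<notin> Poly_Mapping.keys b" using ab by auto
      then show ?thesis by (simp add: in_keys_iff)
    qed
    then show False using ab(3) poly_mapping_eqI by blast
  qed
  then obtain x where x: "x \<in> ?D" "\<And>y. y \<in> ?D \<Longrightarrow> y \<noteq> x \<Longrightarrow> gt x y"
    using strict_total_max[OF V(1), of ?D] V(2) by auto
  have "?l a y = ?l b y" if "y \<in> V" "gt y x" for y
    using x that strict_total_asym[OF V(1)] by blast
  moreover have "?l a x < ?l b x \<or> ?l b x < ?l a x" "x \<in> V" using x by auto
  ultimately show ?thesis unfolding lex_gt_def by (metis (no_types, lifting))
qed

lemma lead_mon_eqI:
  assumes "strict_total_on V gt" "a \<in> Poly_Mapping.keys p"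
    "\<And>b. b \<in> Poly_Mapping.keys p \<Longrightarrow> b \<noteq> a \<Longrightarrow> lex_gt gt V a b"
  shows "lead_mon gt V p = a"
  unfolding lead_mon_def
proof (rule the_equality)
  show "a \<in> Poly_Mapping.keys p \<and> (\<forall>b\<in>Poly_Mapping.keys p. b \<noteq> a \<longrightarrow> lex_gt gt V a b)"
    using assms(2,3) by blast
  fix c assume c: "c \<in> Poly_Mapping.keys p \<and> (\<forall>b\<in>Poly_Mapping.keys p. b \<noteq> c \<longrightarrow> lex_gt gt V c b)"
  show "c = a"
  proof (rule ccontr)
    assume "c \<noteq> a"
    then have "lex_gt gt V a c" "lex_gt gt V c a" using assms(2,3) c by auto
    then show False using lex_gt_asym[OF assms(1)] by simp
  qed
qed

lemma lead_mon_max: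
  assumes V: "strict_total_on V gt" "finite V" and p: "in_KX V p" "p \<noteq> 0"
  shows "lead_mon gt V p \<in> Poly_Mapping.keys p"
    and "\<And>b. b \<in> Poly_Mapping.keys p \<Longrightarrow> b \<noteq> lead_mon gt V p \<Longrightarrow> lex_gt gt V (lead_mon gt V p) b"
proof -
  have ex: "\<exists>a\<in>K. \<forall>b\<in>K. b \<noteq> a \<longrightarrow> lex_gt gt V a b"
    if "finite K" "K \<noteq> {}" "\<And>a. a \<in> K \<Longrightarrow> Poly_Mapping.keys a \<subseteq> V" for K
    using that
  proof (induction K rule: finite_ne_induct)
    case (insert c K)
    then obtain a where a: "a \<in> K" "\<forall>b\<in>K. b \<noteq> a \<longrightarrow> lex_gt gt V a b" by auto
    have "lex_gt gt V c a \<or> lex_gt gt V a c"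
      using insert.hyps insert.prems a(1) by (intro lex_gt_total[OF V]) auto
    then show ?case
    proof
      assume c: "lex_gt gt V c a"
      then have "lex_gt gt V c b" if "b \<in> K" for b
        using a that lex_gt_trans[OF V(1) c] by (cases "b = a") auto
      then show ?thesis by (intro bexI[of _ c]) auto
    next
      assume "lex_gt gt V a c"
      then show ?thesis using a by (intro bexI[of _ a]) auto
    qed
  qed simp
  obtain a where "a \<in> Poly_Mapping.keys p" "\<And>b. b \<in> Poly_Mapping.keys p \<Longrightarrow> b \<noteq> a \<Longrightarrow> lex_gt gt V a b"
    using ex[of "Poly_Mapping.keys p"] p by (auto simp: in_KX_def)
  moreover from lead_mon_eqI[OF V(1) this] have "lead_mon gt V p = a" .
  ultimately show "lead_mon gt V p \<in> Poly_Mapping.keys p"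
    and "\<And>b. b \<in> Poly_Mapping.keys p \<Longrightarrow> b \<noteq> lead_mon gt V p \<Longrightarrow> lex_gt gt V (lead_mon gt V p) b"
    by auto
qed

section \<open>Minors and their leading monomials\<close>

lemma lookup_sum_single_inj:
  assumes "finite I" "inj_on g I"
  shows "Poly_Mapping.lookup (\<Sum>l\<in>I. Poly_Mapping.single (g l) (1::nat)) y = (if y \<in> g ` I then 1 else 0)"
proof -
  have "(\<Sum>l\<in>I. Poly_Mapping.single (g l) (1::nat)) = (\<Sum>z\<in>g ` I. Poly_Mapping.single z 1)"
    using assms by (simp add: sum.reindex)
  then show ?thesis using assms(1) by (simp add: lookup_sum lookup_single when_def)
qed

lemma leibniz_eq_sum_single:
  fixes E :: "nat \<Rightarrow> nat \<Rightarrow> qvar"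
  shows "(\<Sum>p\<in>{p. p permutes {..<n}}. of_int (sign p) * (\<Prod>l<n. Var (E l (p l))))
    = (\<Sum>p\<in>{p. p permutes {..<n}}.
         Poly_Mapping.single (\<Sum>l<n. Poly_Mapping.single (E l (p l)) 1) (of_int (sign p) :: 'a::comm_ring_1))"
proof (intro sum.cong refl)
  fix p :: "nat \<Rightarrow> nat"
  have "(of_int (sign p) :: 'a mpoly) = Poly_Mapping.single 0 (of_int (sign p))" by simp
  then show "(of_int (sign p) :: 'a mpoly) * (\<Prod>l<n. Var (E l (p l)))
      = Poly_Mapping.single (\<Sum>l<n. Poly_Mapping.single (E l (p l)) 1) (of_int (sign p))"
    by (simp only: Var_def prod_single[OF finite_lessThan] mult_single) simp
qed

lemma keys_sum_single_subset:
  "Poly_Mapping.keys (\<Sum>l\<in>I. Poly_Mapping.single (g l) (1::nat)) \<subseteq> g ` I"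
  using keys_sum[of "\<lambda>l. Poly_Mapping.single (g l) (1::nat)" I] by auto

lemma in_KX_leibniz:
  fixes E :: "nat \<Rightarrow> nat \<Rightarrow> qvar"
  assumes "\<And>l l'. l < n \<Longrightarrow> l' < n \<Longrightarrow> E l l' \<in> V"
  shows "in_KX V (\<Sum>p\<in>{p. p permutes {..<n}}. of_int (sign p) * (\<Prod>l<n. Var (E l (p l)) :: 'a::comm_ring_1 mpoly))"
  unfolding in_KX_def
proof
  let ?M = "\<lambda>p. \<Sum>l<n. Poly_Mapping.single (E l (p l)) (1::nat)"
  fix a assume "a \<in> Poly_Mapping.keys (\<Sum>p\<in>{p. p permutes {..<n}}. of_int (sign p) * (\<Prod>l<n. Var (E l (p l)) :: 'a mpoly))"
  then have "a \<in> (\<Union>p\<in>{p. p permutes {..<n}}. Poly_Mapping.keys (Poly_Mapping.single (?M p) (of_int (sign p) :: 'a)))"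
    unfolding leibniz_eq_sum_single[of E] by (rule subsetD[OF keys_sum])
  then obtain p where p: "p permutes {..<n}" "a = ?M p" by (auto split: if_splits)
  then have "Poly_Mapping.keys a \<subseteq> (\<lambda>l. E l (p l)) ` {..<n}" using keys_sum_single_subset by simp
  also have "\<dots> \<subseteq> V" using assms permutes_in_image[OF p(1)] by (auto simp: image_subset_iff)
  finally show "Poly_Mapping.keys a \<subseteq> V" .
qed

text \<open>Comparing the diagonal with another permutation \<open>p\<close>, the deciding variable
  is the largest diagonal entry that \<open>p\<close> moves away from. Any off-diagonal entry used
  by \<open>p\<close> is smaller than one of these moved diagonal entries, so above the deciding
  variable only common diagonal entries remain.\<close>

lemma leibniz_lead:
  fixes E :: "nat \<Rightarrow> nat \<Rightarrow> qvar" and n :: nat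
  defines "f \<equiv> (\<Sum>p\<in>{p. p permutes {..<n}}. of_int (sign p) * (\<Prod>l<n. Var (E l (p l)))) :: 'a::comm_ring_1 mpoly"
  assumes V: "strict_total_on V gt"
    and EV: "\<And>l l'. l < n \<Longrightarrow> l' < n \<Longrightarrow> E l l' \<in> V"
    and inj: "\<And>l l' k k'. l < n \<Longrightarrow> l' < n \<Longrightarrow> k < n \<Longrightarrow> k' < n \<Longrightarrow> E l l' = E k k' \<Longrightarrow> l = k \<and> l' = k'"
    and right: "\<And>l a b. l < n \<Longrightarrow> b < n \<Longrightarrow> a < b \<Longrightarrow> gt (E l a) (E l b)"
    and down: "\<And>l a b. l < n \<Longrightarrow> b < n \<Longrightarrow> a < b \<Longrightarrow> gt (E a l) (E b l)"
  shows "f \<noteq> 0" and "lead_mon gt V f = (\<Sum>l<n. Poly_Mapping.single (E l l) 1)"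
proof -
  define M where "M p = (\<Sum>l<n. Poly_Mapping.single (E l (p l)) (1::nat))" for p
  have f: "f = (\<Sum>p\<in>{p. p permutes {..<n}}. Poly_Mapping.single (M p) (of_int (sign p)))"
    unfolding f_def M_def by (rule leibniz_eq_sum_single)
  have M: "Poly_Mapping.lookup (M p) y = (if y \<in> (\<lambda>l. E l (p l)) ` {..<n} then 1 else 0)"
    if "p permutes {..<n}" for p y
  proof -
    have "inj_on (\<lambda>l. E l (p l)) {..<n}"
      using inj permutes_in_image[OF that] by (intro inj_onI) (metis lessThan_iff)
    then show ?thesis unfolding M_def by (intro lookup_sum_single_inj) auto
  qed
  have gtM: "lex_gt gt V (M id) (M p)" if p: "p permutes {..<n}" "p \<noteq> id" for p
  proof -
    have pn: "p l < n" if "l < n" for l using permutes_in_image[OF p(1), of l] that by simp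
    have pinj: "p a = p b \<Longrightarrow> a = b" for a b using permutes_inj[OF p(1)] by (simp add: inj_def)
    define W where "W = (\<lambda>l. E l l) ` {l. l < n \<and> p l \<noteq> l}"
    have "W \<noteq> {}"
    proof -
      obtain l where l: "p l \<noteq> l" using p(2) by fastforce
      then have "l < n" using p(1) unfolding permutes_def by blast
      then show ?thesis using l by (auto simp: W_def)
    qed
    moreover have "finite W" "W \<subseteq> V" by (auto simp: W_def intro: EV)
    ultimately obtain x where x: "x \<in> W" "\<And>y. y \<in> W \<Longrightarrow> y \<noteq> x \<Longrightarrow> gt x y"
      using strict_total_max[OF V] by metis
    have WV: "x \<in> V" using x \<open>W \<subseteq> V\<close> by auto
    have noW: "\<not> gt y x" if "y \<in> W" for y
      using x that strict_total_asym[OF V] \<open>W \<subseteq> V\<close> by blast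
    obtain l where l: "l < n" "p l \<noteq> l" "x = E l l" using x(1) by (auto simp: W_def)
    have "x \<notin> (\<lambda>l. E l (p l)) ` {..<n}"
    proof
      assume "x \<in> (\<lambda>l. E l (p l)) ` {..<n}"
      then obtain t where "t < n" "E l l = E t (p t)" using l(3) by auto
      then show False using inj[of l l t "p t"] l pn by auto
    qed
    moreover have "x \<in> (\<lambda>l. E l (id l)) ` {..<n}" using l by auto
    ultimately have 1: "Poly_Mapping.lookup (M id) x > Poly_Mapping.lookup (M p) x"
      using M[OF p(1)] M[OF permutes_id] by simp
    have 2: "Poly_Mapping.lookup (M id) y = Poly_Mapping.lookup (M p) y" if y: "y \<in> V" "gt y x" for y
    proof -
      have diag: "p t = t" if t: "t < n" "y = E t t" for t
      proof (rule ccontr)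
        assume "p t \<noteq> t"
        then have "y \<in> W" using t by (auto simp: W_def)
        then show False using noW y by blast
      qed
      have perm: "p t = t" if t: "t < n" "y = E t (p t)" for t
      proof (rule ccontr)
        assume nt: "p t \<noteq> t"
        then have "p (p t) \<noteq> p t" using pinj by blast
        then have W: "E t t \<in> W" "E (p t) (p t) \<in> W" using t nt pn by (auto simp: W_def)
        \<comment> \<open>The entry \<open>y\<close> lies to the right of \<open>E t t\<close> if
          \<open>t < p t\<close>, and below the diagonal entry of its column otherwise. Both
          diagonal entries are moved by \<open>p\<close>, the second by injectivity.\<close>
        have "gt (E t t) y \<or> gt (E (p t) (p t)) y"
          using nt t pn right[of t "p t" t] down[of "p t" t "p t"] by (cases "t < p t") auto
        then obtain z where z: "z \<in> W" "gt z y" using W by blast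
        then have "gt z x" using V y \<open>W \<subseteq> V\<close> WV unfolding strict_total_on_def by blast
        then show False using noW z by blast
      qed
      have "y \<in> (\<lambda>l. E l (id l)) ` {..<n} \<longleftrightarrow> y \<in> (\<lambda>l. E l (p l)) ` {..<n}"
      proof
        assume "y \<in> (\<lambda>l. E l (id l)) ` {..<n}"
        then obtain t where t: "t < n" "y = E t t" by auto
        then show "y \<in> (\<lambda>l. E l (p l)) ` {..<n}" using diag[OF t] by (intro image_eqI[of _ _ t]) auto
      next
        assume "y \<in> (\<lambda>l. E l (p l)) ` {..<n}"
        then obtain t where t: "t < n" "y = E t (p t)" by auto
        then show "y \<in> (\<lambda>l. E l (id l)) ` {..<n}" using perm[OF t] by (intro image_eqI[of _ _ t]) auto
      qed
      then show ?thesis using M[OF p(1)] M[OF permutes_id] by simp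
    qed
    show ?thesis unfolding lex_gt_def using 1 2 WV by blast
  qed
  have ne: "M p \<noteq> M id" if "p permutes {..<n}" "p \<noteq> id" for p
    using gtM[OF that] lex_gt_asym[OF V] by metis
  have "Poly_Mapping.lookup f (M id) = (\<Sum>p\<in>{p. p permutes {..<n}}. if p = id then 1 else 0)"
    unfolding f lookup_sum using ne by (intro sum.cong) (auto simp: lookup_single when_def)
  also have "\<dots> = 1" by (simp add: finite_permutations permutes_id)
  finally have id: "M id \<in> Poly_Mapping.keys f" by (simp add: in_keys_iff)
  then show "f \<noteq> 0" by auto
  have "lex_gt gt V (M id) b" if b: "b \<in> Poly_Mapping.keys f" "b \<noteq> M id" for b
  proof -
    have "b \<in> (\<Union>p\<in>{p. p permutes {..<n}}. Poly_Mapping.keys (Poly_Mapping.single (M p) (of_int (sign p) :: 'a)))"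
      using b(1) unfolding f by (rule subsetD[OF keys_sum])
    then obtain p where "p permutes {..<n}" "b = M p" by (auto split: if_splits)
    then show ?thesis using gtM b(2) by metis
  qed
  then show "lead_mon gt V f = (\<Sum>l<n. Poly_Mapping.single (E l l) 1)"
    using lead_mon_eqI[OF V id] by (simp add: M_def)
qed

text \<open>\<open>pos\<close> is a two-sided inverse of the entry function of \<open>A\<close>, so
  the entries are distinct and \<open>W\<close> is the set of all of them. This lets sink and source
  matrices be treated alike.\<close>

definition places :: "Defs.mat \<Rightarrow> qvar set \<Rightarrow> (qvar \<Rightarrow> nat \<times> nat) \<Rightarrow> bool" where
  "places A W pos \<longleftrightarrow>
     (\<forall>x\<in>W. fst (pos x) < fst A \<and> snd (pos x) < fst (snd A) \<and> snd (snd A) (fst (pos x)) (snd (pos x)) = x) \<and>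
     (\<forall>i<fst A. \<forall>c<fst (snd A). snd (snd A) i c \<in> W \<and> pos (snd (snd A) i c) = (i, c))"

lemma minor_conv:
  "minor A R C = (\<Sum>p \<in> {p. p permutes {..<card R}}. of_int (sign p) *
     (\<Prod>l<card R. Var (snd (snd A) (sorted_list_of_set R ! l) (sorted_list_of_set C ! p l))))"
  by (simp add: minor_def Let_def)

lemma sorted_list_of_set_nth:
  fixes R :: "nat set"
  assumes "R \<subseteq> {..<n}" "l < card R"
  shows "sorted_list_of_set R ! l \<in> R" "sorted_list_of_set R ! l < n"
proof -
  have "finite R" using assms(1) finite_subset by blast
  then have "sorted_list_of_set R ! l \<in> set (sorted_list_of_set R)"
    using assms(2) by (intro nth_mem) simp
  then show *: "sorted_list_of_set R ! l \<in> R" using \<open>finite R\<close> by simp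
  show "sorted_list_of_set R ! l < n" using * assms(1) by auto
qed

lemma in_KX_minor:
  assumes "places A W pos" "W \<subseteq> V" "R \<subseteq> {..<fst A}" "C \<subseteq> {..<fst (snd A)}" "card C = card R"
  shows "in_KX V (minor A R C)"
  unfolding minor_conv
proof (rule in_KX_leibniz)
  fix l l' assume "l < card R" "l' < card R"
  then have "sorted_list_of_set R ! l < fst A" "sorted_list_of_set C ! l' < fst (snd A)"
    using sorted_list_of_set_nth(2)[OF assms(3), of l] sorted_list_of_set_nth(2)[OF assms(4), of l'] assms(5) by auto
  then show "snd (snd A) (sorted_list_of_set R ! l) (sorted_list_of_set C ! l') \<in> V"
    using assms(1,2) unfolding places_def by blast
qed

text \<open>A chain that increases strictly in both coordinates is the main diagonal of the
  submatrix on its own rows and columns, and consistency makes this diagonal the leading monomial.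
  It is squarefree, so it divides every monomial whose support contains the chain.\<close>

lemma minor_of_chain:
  assumes V: "strict_total_on V gt" and cons: "consistent_with gt A" and pl: "places A W pos" and "W \<subseteq> V"
    and Ch: "Ch \<subseteq> W" "chain_of R Ch" "card Ch = Suc n"
    and R: "\<And>x y. x \<in> W \<Longrightarrow> y \<in> W \<Longrightarrow> R x y \<Longrightarrow> fst (pos x) < fst (pos y) \<and> snd (pos x) < snd (pos y)"
  shows "\<exists>g\<in>(minors (Suc n) A :: 'a::comm_ring_1 mpoly set). g \<noteq> 0 \<and>
    (\<forall>a. Ch \<subseteq> Poly_Mapping.keys a \<longrightarrow> mon_dvd (lead_mon gt V g) a)"
proof -
  define r where "r x = fst (pos x)" for x
  define c where "c x = snd (pos x)" for x
  define rows where "rows = sorted_list_of_set (r ` Ch)"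
  define cols where "cols = sorted_list_of_set (c ` Ch)"
  let ?e = "snd (snd A)"
  have fin: "finite Ch" using Ch(3) card.infinite by fastforce
  have cmp: "r x < r y \<and> c x < c y \<or> r y < r x \<and> c y < c x" if "x \<in> Ch" "y \<in> Ch" "x \<noteq> y" for x y
    using that Ch R[of x y] R[of y x] unfolding chain_of_def r_def c_def by blast
  have inj: "inj_on r Ch" "inj_on c Ch" using cmp by (force simp: inj_on_def)+
  have card: "card (r ` Ch) = Suc n" "card (c ` Ch) = Suc n" using inj Ch(3) by (simp_all add: card_image)
  have sub: "r ` Ch \<subseteq> {..<fst A}" "c ` Ch \<subseteq> {..<fst (snd A)}"
    using pl Ch(1) unfolding places_def r_def c_def by auto
  have rows: "set rows = r ` Ch" "sorted rows" "distinct rows" "length rows = Suc n"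
    unfolding rows_def using fin card by auto
  define g where "g = the_inv_into Ch r"
  have g: "g i \<in> Ch" "r (g i) = i" if "i \<in> r ` Ch" for i
    unfolding g_def using that inj(1) by (auto simp: the_inv_into_into f_the_inv_into_f)
  \<comment> \<open>\<open>g\<close> finds the chain element in a given row. Running through the
    rows in increasing order, the columns also increase, so the l-th row and the l-th column meet in
    the chain.\<close>
  have "sorted_wrt (<) (map (c \<circ> g) rows)"
    unfolding sorted_wrt_map
  proof (rule sorted_wrt_mono_rel[of rows "(<)"])
    show "sorted_wrt (<) rows" using rows by (simp add: strict_sorted_iff)
    fix i j assume "i \<in> set rows" "j \<in> set rows" "i < j"
    then have "g i \<in> Ch" "g j \<in> Ch" "r (g i) < r (g j)" using g[of i] g[of j] rows(1) by simp_all
    then show "(c \<circ> g) i < (c \<circ> g) j" using cmp[of "g i" "g j"] by fastforce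
  qed
  moreover have "set (map (c \<circ> g) rows) = c ` Ch"
  proof -
    have "g ` r ` Ch = Ch" using inj(1) by (auto simp: g_def the_inv_into_f_f image_image)
    then show ?thesis using rows(1) by (metis image_comp list.set_map)
  qed
  ultimately have cols: "cols = map (c \<circ> g) rows"
    unfolding cols_def using sorted_list_of_set.idem_if_sorted_distinct[of "map (c \<circ> g) rows"]
    by (metis strict_sorted_iff)
  have cellCh: "?e (rows ! l) (cols ! l) \<in> Ch" if "l < Suc n" for l
  proof -
    have "rows ! l \<in> r ` Ch" using rows that nth_mem by metis
    note gl = g[OF this]
    have "?e (r (g (rows ! l))) (c (g (rows ! l))) = g (rows ! l)"
      using pl Ch(1) gl(1) unfolding places_def r_def c_def by blast
    then show ?thesis using gl that rows(4) by (simp add: cols)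
  qed
  have rl: "rows ! l < fst A" if "l < Suc n" for l
    using sorted_list_of_set_nth(2)[OF sub(1)] card that by (simp add: rows_def)
  have cl: "cols ! l < fst (snd A)" if "l < Suc n" for l
    using sorted_list_of_set_nth(2)[OF sub(2)] card that by (simp add: cols_def)
  have lt: "rows ! a < rows ! b" "cols ! a < cols ! b" if "a < b" "b < Suc n" for a b
  proof -
    have "sorted_wrt (<) rows" "sorted_wrt (<) cols" "length cols = Suc n"
      unfolding rows_def cols_def using fin card by auto
    then show "rows ! a < rows ! b" "cols ! a < cols ! b"
      using that rows(4) by (auto simp: sorted_wrt_iff_nth_less)
  qed
  let ?f = "minor A (r ` Ch) (c ` Ch) :: 'a mpoly"
  have f: "?f = (\<Sum>p \<in> {p. p permutes {..<Suc n}}. of_int (sign p) * (\<Prod>l<Suc n. Var (?e (rows ! l) (cols ! p l))))"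
    unfolding minor_conv card rows_def cols_def ..
  define E where "E l l' = ?e (rows ! l) (cols ! l')" for l l'
  have EV: "E l l' \<in> V" if "l < Suc n" "l' < Suc n" for l l'
    using pl \<open>W \<subseteq> V\<close> rl cl that unfolding places_def E_def by blast
  have inj: "l = k \<and> l' = k'"
    if b: "l < Suc n" "l' < Suc n" "k < Suc n" "k' < Suc n" and eq: "E l l' = E k k'" for l l' k k'
  proof -
    have "pos (E l l') = (rows ! l, cols ! l')" "pos (E k k') = (rows ! k, cols ! k')"
      using pl b rl cl unfolding places_def E_def by blast+
    then have "rows ! l = rows ! k" "cols ! l' = cols ! k'" using eq by auto
    then show ?thesis using lt[of l k] lt[of k l] lt[of l' k'] lt[of k' l'] b by (metis linorder_neqE_nat less_irrefl)
  qed
  have right: "gt (E l a) (E l b)" if "l < Suc n" "b < Suc n" "a < b" for l a b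
    using cons rl[of l] cl[of a] cl[of b] lt[of a b] that unfolding consistent_with_def Let_def E_def by auto
  have down: "gt (E a l) (E b l)" if "l < Suc n" "b < Suc n" "a < b" for l a b
    using cons cl[of l] rl[of a] rl[of b] lt[of a b] that unfolding consistent_with_def Let_def E_def by auto
  have lead: "?f \<noteq> 0" "lead_mon gt V ?f = (\<Sum>l<Suc n. Poly_Mapping.single (E l l) 1)"
    unfolding f E_def[symmetric]
    by ((rule leibniz_lead[where E = E and n = "Suc n", OF V]), fact EV, fact inj, fact right, fact down)+
  have "mon_dvd (lead_mon gt V ?f) a" if "Ch \<subseteq> Poly_Mapping.keys a" for a
  proof -
    have "inj_on (\<lambda>l. E l l) {..<Suc n}"
      using inj by (intro inj_onI) auto
    then have "Poly_Mapping.lookup (lead_mon gt V ?f) y = (if y \<in> (\<lambda>l. E l l) ` {..<Suc n} then 1 else 0)" for y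
      unfolding lead(2) by (intro lookup_sum_single_inj) auto
    moreover have "Poly_Mapping.lookup a y \<noteq> 0" if "y \<in> (\<lambda>l. E l l) ` {..<Suc n}" for y
    proof -
      have "y \<in> Ch" using that cellCh by (auto simp: E_def)
      then show ?thesis using \<open>Ch \<subseteq> Poly_Mapping.keys a\<close> by (auto simp: in_keys_iff)
    qed
    ultimately show ?thesis by (auto simp: mon_dvd_def Suc_le_eq)
  qed
  moreover have "?f \<in> minors (Suc n) A" using card sub unfolding minors_def by blast
  ultimately show ?thesis using lead(1) by blast
qed

text \<open>Consistency compares only entries of one row or one column; two entries in general
  north-west position are compared through the corner in the row of \<open>x\<close> and the column
  of \<open>y\<close>.\<close>

lemma consistent_gt:
  assumes V: "strict_total_on V gt" and cons: "consistent_with gt A" and pl: "places A W pos" and "W \<subseteq> V"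
    and xy: "x \<in> W" "y \<in> W" "fst (pos x) \<le> fst (pos y)" "snd (pos x) \<le> snd (pos y)" "x \<noteq> y"
  shows "gt x y"
proof -
  let ?e = "snd (snd A)"
  obtain i c where ic: "pos x = (i, c)" by fastforce
  obtain i' c' where ic': "pos y = (i', c')" by fastforce
  have e: "?e i c = x" "?e i' c' = y" "i < fst A" "i' < fst A" "c < fst (snd A)" "c' < fst (snd A)"
    using pl xy(1,2) ic ic' unfolding places_def by auto
  have z: "?e i c' \<in> V" using pl e \<open>W \<subseteq> V\<close> unfolding places_def by blast
  have V3: "x \<in> V" "y \<in> V" using xy(1,2) \<open>W \<subseteq> V\<close> by auto
  have right: "gt x (?e i c')" if "c < c'"
    using cons e that by (auto simp: consistent_with_def Let_def)
  have down: "gt (?e i c') y" if "i < i'"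
    using cons e that by (auto simp: consistent_with_def Let_def)
  consider "i = i'" "c < c'" | "c = c'" "i < i'" | "i < i'" "c < c'"
    using xy(3-5) ic ic' e by force
  then show ?thesis
  proof cases
    case 1
    then show ?thesis using right e by simp
  next
    case 2
    then show ?thesis using down e by simp
  next
    case 3
    note right[OF 3(2)] down[OF 3(1)]
    then show ?thesis using V z V3 unfolding strict_total_on_def by blast
  qed
qed

lemma subst_minor_eq_0:
  assumes V: "finite V" and pl: "places A W pos" "W \<subseteq> V"
    and fac: "\<And>i c. i < fst A \<Longrightarrow> c < fst (snd A) \<Longrightarrow> \<theta> (snd (snd A) i c) = (\<Sum>s<u. F i s * G s c)"
    and f: "f \<in> minors (u + 1) A"
  shows "subst_poly V \<theta> f = 0"
proof -
  obtain R C where RC: "f = minor A R C" "R \<subseteq> {..<fst A}" "C \<subseteq> {..<fst (snd A)}" "card R = u + 1" "card C = u + 1"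
    using f unfolding minors_def by blast
  define rs cs where "rs = sorted_list_of_set R" and "cs = sorted_list_of_set C"
  have rc: "rs ! l < fst A" "cs ! l < fst (snd A)" if "l < u + 1" for l
    using sorted_list_of_set_nth(2)[OF RC(2), of l] sorted_list_of_set_nth(2)[OF RC(3), of l] RC(4,5) that
    by (simp_all add: rs_def cs_def)
  have "subst_poly V \<theta> f = (\<Sum>p\<in>{p. p permutes {..<u + 1}}. of_int (sign p) *
      (\<Prod>l<u + 1. subst_poly V \<theta> (Var (snd (snd A) (rs ! l) (cs ! p l)))))"
    unfolding RC(1) minor_conv RC(4) rs_def cs_def
    by (simp only: subst_poly_sum subst_poly_mult subst_poly_prod subst_poly_sign)
  also have "\<dots> = 0"
  proof (rule leibniz_low_rank[where F = "\<lambda>i s. F (rs ! i) s" and G = "\<lambda>s j. G s (cs ! j)" and u = u])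
    fix i j assume ij: "i < u + 1" "j < u + 1"
    have "snd (snd A) (rs ! i) (cs ! j) \<in> V" using pl rc ij unfolding places_def by blast
    then show "subst_poly V \<theta> (Var (snd (snd A) (rs ! i) (cs ! j))) = (\<Sum>s<u. F (rs ! i) s * G s (cs ! j))"
      using fac rc ij by (simp add: subst_poly_Var[OF V])
  qed simp
  finally show ?thesis .
qed

section \<open>Positions in lists ordered by blocks\<close>

definition lex_less :: "nat \<times> nat \<Rightarrow> nat \<times> nat \<Rightarrow> bool" where
  "lex_less a b \<longleftrightarrow> fst a < fst b \<or> fst a = fst b \<and> snd a < snd b"

definition index_of :: "'b list \<Rightarrow> 'b \<Rightarrow> nat" where
  "index_of xs z = (SOME i. i < length xs \<and> xs ! i = z)"

lemma index_of:
  assumes "z \<in> set xs"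
  shows "index_of xs z < length xs" "xs ! index_of xs z = z"
  using someI_ex[of "\<lambda>i. i < length xs \<and> xs ! i = z"] assms
  by (auto simp: index_of_def in_set_conv_nth)

lemma index_of_nth: "distinct xs \<Longrightarrow> i < length xs \<Longrightarrow> index_of xs (xs ! i) = i"
  using index_of[of "xs ! i" xs] by (simp add: nth_eq_iff_index_eq)

lemma index_of_less:
  assumes "sorted_wrt lex_less xs" "a \<in> set xs" "b \<in> set xs" "lex_less a b"
  shows "index_of xs a < index_of xs b"
proof (rule ccontr)
  assume n: "\<not> ?thesis"
  have "index_of xs a \<noteq> index_of xs b"
    using index_of assms by (metis lex_less_def less_irrefl)
  then have "lex_less b a"
    using n sorted_wrt_nth_less[OF assms(1), of "index_of xs b" "index_of xs a"]
      index_of[OF assms(2)] index_of[OF assms(3)] by simp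
  then show False using assms(4) by (auto simp: lex_less_def)
qed

lemma sorted_blocks:
  "sorted_wrt (<) ks \<Longrightarrow> sorted_wrt lex_less (concat (map (\<lambda>k. map (\<lambda>j. (k, j)) [0..<n k]) ks))"
proof (induction ks)
  case (Cons k ks)
  have "sorted_wrt lex_less (map (\<lambda>j. (k, j)) [0..<n k])"
    by (simp add: sorted_wrt_map lex_less_def)
  moreover have "lex_less x y" if "x \<in> set (map (\<lambda>j. (k, j)) [0..<n k])"
    "y \<in> set (concat (map (\<lambda>k. map (\<lambda>j. (k, j)) [0..<n k]) ks))" for x y
    using that Cons.prems by (auto simp: lex_less_def)
  ultimately show ?case using Cons by (simp add: sorted_wrt_append)
qed simp

lemma distinct_lex_sorted: "sorted_wrt lex_less xs \<Longrightarrow> distinct xs"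
  by (induction xs) (auto simp: lex_less_def)

section \<open>The rank parametrization\<close>

text \<open>\<open>PV v i p\<close> is the entry (i, p) of the left factor at the sink
  \<open>v\<close>, \<open>ZV k p q\<close> the entry (p, q) of the middle factor of the arrow
  \<open>k\<close>, and \<open>QV v j q\<close> the entry (q, j) of the right factor at the source
  \<open>v\<close>. The outer factors are shared by all arrows at a vertex, which makes their
  exponents count whole rows and columns of the concatenated matrices; the middle ones count single
  blocks.\<close>

datatype pvar = PV nat nat nat | ZV nat nat nat | QV nat nat nat

definition color_weight :: "(nat \<Rightarrow> nat) \<Rightarrow> (nat \<Rightarrow> nat) \<Rightarrow> qvar \<Rightarrow> nat \<times> nat \<Rightarrow> pvar \<Rightarrow>\<^sub>0 nat" where
  "color_weight tgt src x c =
     Poly_Mapping.single (PV (tgt (fst x)) (row_ix x) (fst c)) 1 +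
     Poly_Mapping.single (ZV (fst x) (fst c) (snd c)) 1 +
     Poly_Mapping.single (QV (src (fst x)) (col_ix x) (snd c)) 1"

definition colors :: "(nat \<Rightarrow> nat) \<Rightarrow> (nat \<Rightarrow> nat) \<Rightarrow> (nat \<Rightarrow> nat) \<Rightarrow> qvar \<Rightarrow> (nat \<times> nat) set" where
  "colors tgt src u x = {..<u (tgt (fst x))} \<times> {..<u (src (fst x))}"

definition rank_param :: "(nat \<Rightarrow> nat) \<Rightarrow> (nat \<Rightarrow> nat) \<Rightarrow> (nat \<Rightarrow> nat) \<Rightarrow> qvar \<Rightarrow> (pvar \<Rightarrow>\<^sub>0 nat) \<Rightarrow>\<^sub>0 'a::comm_ring_1" where
  "rank_param tgt src u x = (\<Sum>c\<in>colors tgt src u x. Poly_Mapping.single (color_weight tgt src x c) 1)"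

lemma finite_colors [simp]: "finite (colors tgt src u x)"
  by (simp add: colors_def)

text \<open>The bracketing P (Z Q): the left factor depends only on the sink and the row, so it is
  common to all blocks of the sink matrix.\<close>

lemma rank_param_tgt:
  "(rank_param tgt src u (k, i, j) :: _ \<Rightarrow>\<^sub>0 'a::comm_ring_1) =
    (\<Sum>p<u (tgt k). Poly_Mapping.single (Poly_Mapping.single (PV (tgt k) i p) 1) 1 *
      (\<Sum>q<u (src k). Poly_Mapping.single
        (Poly_Mapping.single (ZV k p q) 1 + Poly_Mapping.single (QV (src k) j q) 1) 1))"
  by (simp add: rank_param_def colors_def color_weight_def sum.cartesian_product case_prod_beta
      sum_distrib_left mult_single add.assoc)

text \<open>The bracketing (P Z) Q: the right factor is common to all blocks of the source
  matrix.\<close>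

lemma rank_param_src:
  "(rank_param tgt src u (k, i, j) :: _ \<Rightarrow>\<^sub>0 'a::comm_ring_1) =
    (\<Sum>q<u (src k). (\<Sum>p<u (tgt k). Poly_Mapping.single
        (Poly_Mapping.single (PV (tgt k) i p) 1 + Poly_Mapping.single (ZV k p q) 1) 1) *
      Poly_Mapping.single (Poly_Mapping.single (QV (src k) j q) 1) 1)"
proof -
  have "(rank_param tgt src u (k, i, j) :: _ \<Rightarrow>\<^sub>0 'a) = (\<Sum>p<u (tgt k). \<Sum>q<u (src k).
      Poly_Mapping.single (color_weight tgt src (k, i, j) (p, q)) 1)"
    by (simp add: rank_param_def colors_def sum.cartesian_product case_prod_beta)
  also have "\<dots> = (\<Sum>q<u (src k). \<Sum>p<u (tgt k).
      Poly_Mapping.single (color_weight tgt src (k, i, j) (p, q)) 1)" by (rule sum.swap)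
  finally show ?thesis
    by (simp add: color_weight_def sum_distrib_right mult_single)
qed

text \<open>The exponents of a coloured monomial are exactly the three statistics compared in
  \<open>coloring_rigid\<close>: by sink row and first colour, by source column and second colour,
  and by block and colour pair.\<close>

lemma lookup_weight_sum:
  fixes X :: "'i \<Rightarrow> qvar" and cs :: "'i \<Rightarrow> nat \<times> nat" and tgt src :: "nat \<Rightarrow> nat"
  defines "s I \<equiv> \<Sum>i\<in>I. color_weight tgt src (X i) (cs i)"
  assumes I: "finite I"
  shows "Poly_Mapping.lookup (s I) (PV v r p) = card {i\<in>I. (tgt (fst (X i)), row_ix (X i), fst (cs i)) = (v, r, p)}"
    and "Poly_Mapping.lookup (s I) (QV v r p) = card {i\<in>I. (src (fst (X i)), col_ix (X i), snd (cs i)) = (v, r, p)}"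
    and "Poly_Mapping.lookup (s I) (ZV v r p) = card {i\<in>I. (fst (X i), fst (cs i), snd (cs i)) = (v, r, p)}"
  using I unfolding s_def
  by (simp_all add: color_weight_def lookup_sum lookup_add lookup_single when_def sum.If_cases Int_def prod_eq_iff)

lemma sum_card_fibers:
  assumes "finite I" "finite E" "h ` I \<subseteq> E"
  shows "(\<Sum>e\<in>{e\<in>E. F e}. card {i\<in>I. h i = e}) = card {i\<in>I. F (h i)}"
proof -
  have "card {i\<in>I. F (h i)} = card (\<Union>e\<in>{e\<in>E. F e}. {i\<in>I. h i = e})"
    using assms(3) by (intro arg_cong[where f = card]) auto
  also have "\<dots> = (\<Sum>e\<in>{e\<in>E. F e}. card {i\<in>I. h i = e})"
    using assms(1,2) by (intro card_UN_disjoint) auto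
  finally show ?thesis by simp
qed

text \<open>One slot for each copy of a variable in the monomial: a competing colouring may give the
  copies of one variable different colours.\<close>

abbreviation slots :: "qvar set \<Rightarrow> (qvar \<Rightarrow>\<^sub>0 nat) \<Rightarrow> (qvar \<times> nat) set" where
  "slots V a \<equiv> SIGMA x:V. {..<Poly_Mapping.lookup a x}"

lemma card_slots_fst: "x \<in> V \<Longrightarrow> card {i \<in> slots V b. fst i = x} = Poly_Mapping.lookup b x"
proof -
  assume "x \<in> V"
  then have "{i \<in> slots V b. fst i = x} = Pair x ` {..<Poly_Mapping.lookup b x}" by auto
  then show ?thesis by (simp add: card_image inj_on_def)
qed

text \<open>At the largest variable \<open>x0\<close> where the coloured counts differ, rigidity
  gives B at least as many copies of the height colour as A has. A has all its copies of
  \<open>x0\<close> there, and \<open>b\<close> has no more copies than \<open>a\<close>, so nothing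
  is left for other colours and the counts agree after all.\<close>

lemma coloring_unique:
  fixes V :: "qvar set" and a b :: "qvar \<Rightarrow>\<^sub>0 nat" and tgt src :: "nat \<Rightarrow> nat"
  defines "S \<equiv> Poly_Mapping.keys a"
    and "hP \<equiv> height (blk_less fst row_ix col_ix tgt) (Poly_Mapping.keys a)"
    and "hQ \<equiv> height (blk_less fst col_ix row_ix src) (Poly_Mapping.keys a)"
  assumes V: "strict_total_on V gt" "finite V" and aV: "Poly_Mapping.keys a \<subseteq> V" and bV: "Poly_Mapping.keys b \<subseteq> V"
    and gtP: "\<And>x y. x \<in> V \<Longrightarrow> y \<in> V \<Longrightarrow> tgt (fst x) = tgt (fst y) \<Longrightarrow> row_ix x \<le> row_ix y \<Longrightarrow>
        fst x < fst y \<or> fst x = fst y \<and> col_ix x \<le> col_ix y \<Longrightarrow> x \<noteq> y \<Longrightarrow> gt x y"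
    and gtQ: "\<And>x y. x \<in> V \<Longrightarrow> y \<in> V \<Longrightarrow> src (fst x) = src (fst y) \<Longrightarrow> col_ix x \<le> col_ix y \<Longrightarrow>
        fst x < fst y \<or> fst x = fst y \<and> row_ix x \<le> row_ix y \<Longrightarrow> x \<noteq> y \<Longrightarrow> gt x y"
    and h: "\<And>x. x \<in> S \<Longrightarrow> (hP x, hQ x) \<in> colors tgt src u x"
    and cs: "\<And>i. i \<in> slots V b \<Longrightarrow> cs i \<in> colors tgt src u (fst i)"
    and eq: "(\<Sum>i\<in>slots V b. color_weight tgt src (fst i) (cs i))
           = (\<Sum>i\<in>slots V a. color_weight tgt src (fst i) (hP (fst i), hQ (fst i)))"
    and le: "b = a \<or> lex_gt gt V a b"
  shows "b = a" and "\<And>i. i \<in> slots V b \<Longrightarrow> cs i = (hP (fst i), hQ (fst i))"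
proof -
  define c0 where "c0 x = (hP x, hQ x)" for x
  define A where "A e = card {i \<in> slots V a. (fst i, c0 (fst i)) = e}" for e
  define B where "B e = card {i \<in> slots V b. (fst i, cs i) = e}" for e
  define E where "E = (SIGMA x:V. colors tgt src u x)"
  have E: "finite E" unfolding E_def using V(2) by auto
  have fin: "finite (slots V a)" "finite (slots V b)" using V(2) by auto
  have hE: "(\<lambda>i. (fst i, c0 (fst i))) ` slots V a \<subseteq> E" "(\<lambda>i. (fst i, cs i)) ` slots V b \<subseteq> E"
    using h cs by (auto simp: E_def c0_def S_def in_keys_iff)
  have sumA: "sum A {e\<in>E. F e} = card {i \<in> slots V a. F (fst i, c0 (fst i))}" for F
    unfolding A_def by (rule sum_card_fibers[OF fin(1) E hE(1)])
  have sumB: "sum B {e\<in>E. F e} = card {i \<in> slots V b. F (fst i, cs i)}" for F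
    unfolding B_def by (rule sum_card_fibers[OF fin(2) E hE(2)])
  have totA: "sum A {e\<in>E. fst e = x} = Poly_Mapping.lookup a x" if "x \<in> V" for x
    using card_slots_fst[OF that, of a] by (simp add: sumA)
  have totB: "sum B {e\<in>E. fst e = x} = Poly_Mapping.lookup b x" if "x \<in> V" for x
    using card_slots_fst[OF that, of b] by (simp add: sumB)
  have A_c0: "A (x, c0 x) = Poly_Mapping.lookup a x" if "x \<in> V" for x
  proof -
    have "{i \<in> slots V a. (fst i, c0 (fst i)) = (x, c0 x)} = {i \<in> slots V a. fst i = x}" by auto
    then show ?thesis unfolding A_def using card_slots_fst[OF that] by simp
  qed
  have A0: "c = c0 x \<and> x \<in> S" if "A (x, c) \<noteq> 0" for x c
  proof -
    have "{i \<in> slots V a. (fst i, c0 (fst i)) = (x, c)} \<noteq> {}" using that unfolding A_def by (metis card.empty)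
    then show ?thesis by (auto simp: S_def in_keys_iff)
  qed
  have B_le: "B (x, c) \<le> Poly_Mapping.lookup b x" if "x \<in> V" for x c
    unfolding B_def card_slots_fst[OF that, of b, symmetric] using fin(2) by (intro card_mono) auto
  have B_le2: "B (x, c) + B (x, c') \<le> Poly_Mapping.lookup b x" if "x \<in> V" "c \<noteq> c'" for x c c'
  proof -
    let ?X = "\<lambda>c. {i \<in> slots V b. (fst i, cs i) = (x, c)}"
    have "B (x, c) + B (x, c') = card (?X c \<union> ?X c')"
      unfolding B_def using that fin(2) by (intro card_Un_disjoint[symmetric]) auto
    also have "\<dots> \<le> card {i \<in> slots V b. fst i = x}" using fin(2) by (intro card_mono) auto
    finally show ?thesis using card_slots_fst[OF that(1)] by simp
  qed
  have eq': "Poly_Mapping.lookup (\<Sum>i\<in>slots V b. color_weight tgt src (fst i) (cs i)) y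
      = Poly_Mapping.lookup (\<Sum>i\<in>slots V a. color_weight tgt src (fst i) (c0 (fst i))) y" for y
    using eq by (simp add: c0_def)
  have rows: "sum B {e\<in>E. (tgt (fst (fst e)), row_ix (fst e), fst (snd e)) = t}
      = sum A {e\<in>E. (tgt (fst (fst e)), row_ix (fst e), fst (snd e)) = t}" for t
    unfolding sumA sumB fst_conv snd_conv
    using eq'[of "PV (fst t) (fst (snd t)) (snd (snd t))"]
    unfolding lookup_weight_sum(1)[OF fin(1)] lookup_weight_sum(1)[OF fin(2)] by simp
  have cols: "sum B {e\<in>E. (src (fst (fst e)), col_ix (fst e), snd (snd e)) = t}
      = sum A {e\<in>E. (src (fst (fst e)), col_ix (fst e), snd (snd e)) = t}" for t
    unfolding sumA sumB fst_conv snd_conv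
    using eq'[of "QV (fst t) (fst (snd t)) (snd (snd t))"]
    unfolding lookup_weight_sum(2)[OF fin(1)] lookup_weight_sum(2)[OF fin(2)] by simp
  have blks: "sum B {e\<in>E. (fst (fst e), fst (snd e), snd (snd e)) = t}
      = sum A {e\<in>E. (fst (fst e), fst (snd e), snd (snd e)) = t}" for t
    unfolding sumA sumB fst_conv snd_conv
    using eq'[of "ZV (fst t) (fst (snd t)) (snd (snd t))"]
    unfolding lookup_weight_sum(3)[OF fin(1)] lookup_weight_sum(3)[OF fin(2)] by simp
  have AB: "B e = A e" if "e \<in> E" for e
  proof (rule ccontr)
    assume ne: "B e \<noteq> A e"
    define D where "D = fst ` {e\<in>E. B e \<noteq> A e}"
    have "fst e \<in> D" unfolding D_def using ne that by blast
    moreover have "finite D" "D \<subseteq> V" using E by (auto simp: D_def E_def)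
    ultimately obtain x0 where x0: "x0 \<in> D" "\<And>y. y \<in> D \<Longrightarrow> y \<noteq> x0 \<Longrightarrow> gt x0 y"
      using strict_total_max[OF V(1), of D] by (metis empty_iff)
    have x0V: "x0 \<in> V" using x0(1) \<open>D \<subseteq> V\<close> by auto
    have above: "B e = A e" if "e \<in> E" "gt (fst e) x0" for e
    proof (rule ccontr)
      assume "B e \<noteq> A e"
      then have "fst e \<in> D" using that(1) by (auto simp: D_def)
      then show False using that(2) x0 x0V \<open>D \<subseteq> V\<close> strict_total_asym[OF V(1)] by blast
    qed
    have same: "Poly_Mapping.lookup b y = Poly_Mapping.lookup a y" if "y \<in> V" "gt y x0" for y
      unfolding totA[OF that(1), symmetric] totB[OF that(1), symmetric]
      using above that(2) by (intro sum.cong) auto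
    \<comment> \<open>The variable \<open>z\<close> that decides between \<open>a\<close> and
      \<open>b\<close> cannot be above \<open>x0\<close>, where exponents agree. If it is
      \<open>x0\<close>, then \<open>b\<close> has fewer copies; if it is smaller, equally
      many.\<close>
    have le0: "Poly_Mapping.lookup b x0 \<le> Poly_Mapping.lookup a x0"
      using le
    proof
      assume "lex_gt gt V a b"
      then obtain z where z: "z \<in> V" "Poly_Mapping.lookup a z > Poly_Mapping.lookup b z"
        "\<And>y. y \<in> V \<Longrightarrow> gt y z \<Longrightarrow> Poly_Mapping.lookup a y = Poly_Mapping.lookup b y"
        unfolding lex_gt_def by blast
      have "\<not> gt z x0" using same[of z] z by auto
      then have "z = x0 \<or> gt x0 z" using V(1) z(1) x0V unfolding strict_total_on_def by blast
      then show ?thesis using z(2) z(3)[OF x0V] by auto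
    qed simp
    have x0S: "x0 \<in> S"
    proof (rule ccontr)
      assume n: "x0 \<notin> S"
      then have "Poly_Mapping.lookup b x0 = 0" using le0 by (simp add: S_def in_keys_iff)
      \<comment> \<open>If \<open>x0\<close> did not divide \<open>a\<close>, it would not divide
        \<open>b\<close> either, and both counts would vanish at \<open>x0\<close>, where they
        differ by choice.\<close>
      then have "B (x0, c) = A (x0, c)" for c using B_le[OF x0V, of c] A0[of x0 c] n by fastforce
      then show False using x0(1) by (auto simp: D_def)
    qed
    have "A (x0, c0 x0) \<le> B (x0, c0 x0)"
      unfolding c0_def hP_def hQ_def
    proof (rule coloring_rigid[OF E])
      show "finite (Poly_Mapping.keys a)" by simp
      fix x p q assume "(x, p, q) \<in> E" "A (x, p, q) \<noteq> 0"
      then show "x \<in> Poly_Mapping.keys a \<and> p = height (blk_less fst row_ix col_ix tgt) (Poly_Mapping.keys a) x \<and>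
          q = height (blk_less fst col_ix row_ix src) (Poly_Mapping.keys a) x"
        using A0[of x "(p, q)"] by (simp add: c0_def hP_def hQ_def S_def)
    next
      fix x p q assume "(x, p, q) \<in> E" "tgt (fst x) = tgt (fst x0)" "row_ix x \<le> row_ix x0"
        "fst x < fst x0 \<or> fst x = fst x0 \<and> col_ix x \<le> col_ix x0" "x \<noteq> x0"
      then show "B (x, p, q) = A (x, p, q)" using gtP[of x x0] x0V by (intro above) (auto simp: E_def)
    next
      fix x p q assume "(x, p, q) \<in> E" "src (fst x) = src (fst x0)" "col_ix x \<le> col_ix x0"
        "fst x < fst x0 \<or> fst x = fst x0 \<and> row_ix x \<le> row_ix x0" "x \<noteq> x0"
      then show "B (x, p, q) = A (x, p, q)" using gtQ[of x x0] x0V by (intro above) (auto simp: E_def)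
    next
      show "x0 \<in> Poly_Mapping.keys a" using x0S by (simp add: S_def)
      show "(x0, height (blk_less fst row_ix col_ix tgt) (Poly_Mapping.keys a) x0,
          height (blk_less fst col_ix row_ix src) (Poly_Mapping.keys a) x0) \<in> E"
        using h[OF x0S] x0V by (simp add: E_def hP_def hQ_def)
    qed (rule rows cols blks)+
    then have full: "Poly_Mapping.lookup a x0 \<le> B (x0, c0 x0)" using A_c0[OF x0V] by simp
    have "B (x0, c) = A (x0, c)" for c
    proof (cases "c = c0 x0")
      case True
      then show ?thesis using full B_le[OF x0V, of c] le0 A_c0[OF x0V] by simp
    next
      case False
      then show ?thesis using full B_le2[OF x0V False] le0 A0[of x0 c] by fastforce
    qed
    then show False using x0(1) by (auto simp: D_def)
  qed
  show "b = a"
  proof (rule poly_mapping_eqI)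
    fix x
    show "Poly_Mapping.lookup b x = Poly_Mapping.lookup a x"
    proof (cases "x \<in> V")
      case True
      then show ?thesis unfolding totA[OF True, symmetric] totB[OF True, symmetric]
        using AB by (intro sum.cong) auto
    next
      case False
      then have "x \<notin> Poly_Mapping.keys a" "x \<notin> Poly_Mapping.keys b" using aV bV by auto
      then show ?thesis by (simp add: in_keys_iff)
    qed
  qed
  fix i assume i: "i \<in> slots V b"
  then have "(fst i, cs i) \<in> E" using hE(2) by auto
  moreover have "B (fst i, cs i) \<noteq> 0" unfolding B_def using i fin(2) by auto
  ultimately have "A (fst i, cs i) \<noteq> 0" using AB by simp
  then show "cs i = (hP (fst i), hQ (fst i))" using A0 by (simp add: c0_def)
qed

section \<open>The Groebner basis\<close>

lemma finite_quiver_vars: "finite (quiver_vars r src tgt m)"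
proof -
  have "quiver_vars r src tgt m = (SIGMA k:{..<r}. {..<m (tgt k)} \<times> {..<m (src k)})"
    by (auto simp: quiver_vars_def)
  then show ?thesis by simp
qed

lemma sink_cols_lex:
  "sorted_wrt lex_less (sink_cols r src tgt m \<alpha>)"
  "set (sink_cols r src tgt m \<alpha>) = {(k, j). k < r \<and> tgt k = \<alpha> \<and> j < m (src k)}"
  unfolding sink_cols_def by (rule sorted_blocks) (auto intro: sorted_wrt_filter)

lemma source_rows_lex:
  "sorted_wrt lex_less (source_rows r src tgt m \<beta>)"
  "set (source_rows r src tgt m \<beta>) = {(k, i). k < r \<and> src k = \<beta> \<and> i < m (tgt k)}"
  unfolding source_rows_def by (rule sorted_blocks) (auto intro: sorted_wrt_filter)

definition vertex_vars :: "(nat \<Rightarrow> bool) \<Rightarrow> nat \<Rightarrow> (nat \<Rightarrow> nat) \<Rightarrow> (nat \<Rightarrow> nat) \<Rightarrow> (nat \<Rightarrow> nat) \<Rightarrow> nat \<Rightarrow> qvar set" where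
  "vertex_vars is_source r src tgt m \<gamma> =
     {x \<in> quiver_vars r src tgt m. (if is_source \<gamma> then src else tgt) (fst x) = \<gamma>}"

definition vertex_pos :: "(nat \<Rightarrow> bool) \<Rightarrow> nat \<Rightarrow> (nat \<Rightarrow> nat) \<Rightarrow> (nat \<Rightarrow> nat) \<Rightarrow> (nat \<Rightarrow> nat) \<Rightarrow> nat \<Rightarrow> qvar \<Rightarrow> nat \<times> nat" where
  "vertex_pos is_source r src tgt m \<gamma> x =
     (if is_source \<gamma> then (index_of (source_rows r src tgt m \<gamma>) (fst x, row_ix x), col_ix x)
      else (row_ix x, index_of (sink_cols r src tgt m \<gamma>) (fst x, col_ix x)))"

lemma in_set_sink_cols:
  "x \<in> quiver_vars r src tgt m \<Longrightarrow> tgt (fst x) = \<alpha> \<Longrightarrow> (fst x, col_ix x) \<in> set (sink_cols r src tgt m \<alpha>)"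
  by (auto simp: sink_cols_lex(2) quiver_vars_def)

lemma in_set_source_rows:
  "x \<in> quiver_vars r src tgt m \<Longrightarrow> src (fst x) = \<beta> \<Longrightarrow> (fst x, row_ix x) \<in> set (source_rows r src tgt m \<beta>)"
  by (auto simp: source_rows_lex(2) quiver_vars_def)

lemma vertex_places:
  "places (vertex_mat is_source r src tgt m \<gamma>) (vertex_vars is_source r src tgt m \<gamma>)
     (vertex_pos is_source r src tgt m \<gamma>)"
proof (cases "is_source \<gamma>")
  case True
  let ?l = "source_rows r src tgt m \<gamma>"
  have A: "vertex_mat is_source r src tgt m \<gamma> = (length ?l, m \<gamma>, \<lambda>i j. (fst (?l ! i), snd (?l ! i), j))"
    using True by (simp add: vertex_mat_def source_mat_def Let_def)
  have W: "vertex_vars is_source r src tgt m \<gamma> = {x \<in> quiver_vars r src tgt m. src (fst x) = \<gamma>}"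
    using True by (simp add: vertex_vars_def)
  have pos: "vertex_pos is_source r src tgt m \<gamma> x = (index_of ?l (fst x, row_ix x), col_ix x)" for x
    using True by (simp add: vertex_pos_def)
  show ?thesis
    unfolding places_def A W pos fst_conv snd_conv
  proof (intro conjI ballI allI impI)
    fix x assume x: "x \<in> {x \<in> quiver_vars r src tgt m. src (fst x) = \<gamma>}"
    then have "(fst x, row_ix x) \<in> set ?l" using in_set_source_rows by simp
    note ix = index_of[OF this]
    show "index_of ?l (fst x, row_ix x) < length ?l" by (rule ix)
    show "col_ix x < m \<gamma>" using x by (auto simp: quiver_vars_def)
    show "(fst (?l ! index_of ?l (fst x, row_ix x)), snd (?l ! index_of ?l (fst x, row_ix x)), col_ix x) = x"
      using ix by (simp add: prod_eq_iff)
  next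
    fix i c assume ic: "i < length ?l" "c < m \<gamma>"
    then have "?l ! i \<in> set ?l" by simp
    then have "fst (?l ! i) < r \<and> src (fst (?l ! i)) = \<gamma> \<and> snd (?l ! i) < m (tgt (fst (?l ! i)))"
      unfolding source_rows_lex(2) by auto
    then show "(fst (?l ! i), snd (?l ! i), c) \<in> {x \<in> quiver_vars r src tgt m. src (fst x) = \<gamma>}"
      using ic by (simp add: quiver_vars_def)
    show "(index_of ?l (fst (?l ! i), snd (?l ! i)), c) = (i, c)"
      using index_of_nth[OF distinct_lex_sorted[OF source_rows_lex(1)]] ic by simp
  qed
next
  case False
  let ?l = "sink_cols r src tgt m \<gamma>"
  have A: "vertex_mat is_source r src tgt m \<gamma> = (m \<gamma>, length ?l, \<lambda>i c. (fst (?l ! c), i, snd (?l ! c)))"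
    using False by (simp add: vertex_mat_def sink_mat_def Let_def)
  have W: "vertex_vars is_source r src tgt m \<gamma> = {x \<in> quiver_vars r src tgt m. tgt (fst x) = \<gamma>}"
    using False by (simp add: vertex_vars_def)
  have pos: "vertex_pos is_source r src tgt m \<gamma> x = (row_ix x, index_of ?l (fst x, col_ix x))" for x
    using False by (simp add: vertex_pos_def)
  show ?thesis
    unfolding places_def A W pos fst_conv snd_conv
  proof (intro conjI ballI allI impI)
    fix x assume x: "x \<in> {x \<in> quiver_vars r src tgt m. tgt (fst x) = \<gamma>}"
    then have "(fst x, col_ix x) \<in> set ?l" using in_set_sink_cols by simp
    note ix = index_of[OF this]
    show "index_of ?l (fst x, col_ix x) < length ?l" by (rule ix)
    show "row_ix x < m \<gamma>" using x by (auto simp: quiver_vars_def)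
    show "(fst (?l ! index_of ?l (fst x, col_ix x)), row_ix x, snd (?l ! index_of ?l (fst x, col_ix x))) = x"
      using ix by (simp add: prod_eq_iff)
  next
    fix i c assume ic: "i < m \<gamma>" "c < length ?l"
    then have "?l ! c \<in> set ?l" by simp
    then have "fst (?l ! c) < r \<and> tgt (fst (?l ! c)) = \<gamma> \<and> snd (?l ! c) < m (src (fst (?l ! c)))"
      unfolding sink_cols_lex(2) by auto
    then show "(fst (?l ! c), i, snd (?l ! c)) \<in> {x \<in> quiver_vars r src tgt m. tgt (fst x) = \<gamma>}"
      using ic by (simp add: quiver_vars_def)
    show "(i, index_of ?l (fst (?l ! c), snd (?l ! c))) = (i, c)"
      using index_of_nth[OF distinct_lex_sorted[OF sink_cols_lex(1)]] ic by simp
  qed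
qed

lemma index_of_mono:
  assumes "sorted_wrt lex_less xs" "a \<in> set xs" "b \<in> set xs" "fst a < fst b \<or> fst a = fst b \<and> snd a \<le> snd b"
  shows "index_of xs a \<le> index_of xs b"
proof (cases "a = b")
  case False
  then have "lex_less a b" using assms(4) by (auto simp: lex_less_def prod_eq_iff)
  then show ?thesis using index_of_less[OF assms(1-3)] by simp
qed simp

lemma vertex_vars_subset: "vertex_vars is_source r src tgt m \<gamma> \<subseteq> quiver_vars r src tgt m"
  by (auto simp: vertex_vars_def)

lemma subst_vertex_minor:
  assumes f: "f \<in> (minors (u \<gamma> + 1) (vertex_mat is_source r src tgt m \<gamma>) :: 'a::comm_ring_1 mpoly set)"
  shows "subst_poly (quiver_vars r src tgt m) (rank_param tgt src u) f = 0"
proof (cases "is_source \<gamma>")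
  case True
  let ?A = "vertex_mat is_source r src tgt m \<gamma>"
  let ?l = "source_rows r src tgt m \<gamma>"
  \<comment> \<open>\<open>F\<close> stacks the products P Z of all arrows at the source \<gamma>,
    and \<open>G\<close> is the right factor of \<gamma>; the inner dimension is
    \<open>u \<gamma>\<close>. At a sink the left factor stands alone and the products Z Q are
    concatenated.\<close>
  define F :: "nat \<Rightarrow> nat \<Rightarrow> (pvar \<Rightarrow>\<^sub>0 nat) \<Rightarrow>\<^sub>0 'a" where
    "F i q = (\<Sum>p<u (tgt (fst (?l ! i))). Poly_Mapping.single (Poly_Mapping.single (PV (tgt (fst (?l ! i))) (snd (?l ! i)) p) 1 +
        Poly_Mapping.single (ZV (fst (?l ! i)) p q) 1) 1)" for i q
  define G :: "nat \<Rightarrow> nat \<Rightarrow> (pvar \<Rightarrow>\<^sub>0 nat) \<Rightarrow>\<^sub>0 'a" where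
    "G q j = Poly_Mapping.single (Poly_Mapping.single (QV \<gamma> j q) 1) 1" for q j
  have "rank_param tgt src u (snd (snd ?A) i j) = (\<Sum>q<u \<gamma>. F i q * G q j)"
    if "i < fst ?A" for i j
  proof -
    have "i < length ?l" using that True by (simp add: vertex_mat_def source_mat_def Let_def)
    then have "?l ! i \<in> set ?l" by simp
    then have "src (fst (?l ! i)) = \<gamma>" unfolding source_rows_lex(2) by auto
    then show ?thesis using True
      by (simp add: vertex_mat_def source_mat_def Let_def rank_param_src F_def G_def)
  qed
  then show ?thesis
    by (intro subst_minor_eq_0[where F = F and G = G, OF finite_quiver_vars vertex_places vertex_vars_subset _ f])
next
  case False
  let ?A = "vertex_mat is_source r src tgt m \<gamma>"
  let ?l = "sink_cols r src tgt m \<gamma>"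
  define F :: "nat \<Rightarrow> nat \<Rightarrow> (pvar \<Rightarrow>\<^sub>0 nat) \<Rightarrow>\<^sub>0 'a" where
    "F i p = Poly_Mapping.single (Poly_Mapping.single (PV \<gamma> i p) 1) 1" for i p
  define G :: "nat \<Rightarrow> nat \<Rightarrow> (pvar \<Rightarrow>\<^sub>0 nat) \<Rightarrow>\<^sub>0 'a" where
    "G p c = (\<Sum>q<u (src (fst (?l ! c))). Poly_Mapping.single (Poly_Mapping.single (ZV (fst (?l ! c)) p q) 1 +
        Poly_Mapping.single (QV (src (fst (?l ! c))) (snd (?l ! c)) q) 1) 1)" for p c
  have "rank_param tgt src u (snd (snd ?A) i c) = (\<Sum>p<u \<gamma>. F i p * G p c)"
    if "c < fst (snd ?A)" for i c
  proof -
    have "c < length ?l" using that False by (simp add: vertex_mat_def sink_mat_def Let_def)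
    then have "?l ! c \<in> set ?l" by simp
    then have "tgt (fst (?l ! c)) = \<gamma>" unfolding sink_cols_lex(2) by auto
    then show ?thesis using False
      by (simp add: vertex_mat_def sink_mat_def Let_def rank_param_tgt F_def G_def)
  qed
  then show ?thesis
    by (intro subst_minor_eq_0[where F = F and G = G, OF finite_quiver_vars vertex_places vertex_vars_subset _ f])
qed

lemma lookup_const_mult:
  "Poly_Mapping.lookup (Poly_Mapping.single 0 c * p) k = c * Poly_Mapping.lookup p k"
  by (simp add: mult_map_scale_conv_mult[symmetric] Poly_Mapping.map.rep_eq when_def)

lemma in_KX_mult_add:
  assumes "in_KX V c" "in_KX V g" "in_KX V f"
  shows "in_KX V (c * g + f :: 'a::comm_ring_1 mpoly)"
  unfolding in_KX_def
proof
  fix a assume "a \<in> Poly_Mapping.keys (c * g + f)"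
  then have "a \<in> Poly_Mapping.keys (c * g) \<or> a \<in> Poly_Mapping.keys f" using Poly_Mapping.keys_add[of "c * g" f] by blast
  then show "Poly_Mapping.keys a \<subseteq> V"
  proof
    assume "a \<in> Poly_Mapping.keys (c * g)"
    then obtain x y where xy: "x \<in> Poly_Mapping.keys c" "y \<in> Poly_Mapping.keys g" "a = x + y"
      using subsetD[OF keys_mult] by blast
    have "Poly_Mapping.keys a \<subseteq> Poly_Mapping.keys x \<union> Poly_Mapping.keys y"
      unfolding xy(3) by (rule Poly_Mapping.keys_add)
    then show ?thesis using assms(1,2) xy unfolding in_KX_def by blast
  qed (use assms(3) in \<open>simp add: in_KX_def\<close>)
qed

theorem theorem1p2:
  fixes d r :: nat
    and is_source :: "nat \<Rightarrow> bool"
    and src tgt :: "nat \<Rightarrow> nat"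
    and m u :: "nat \<Rightarrow> nat"
    and gt :: "qvar \<Rightarrow> qvar \<Rightarrow> bool"
  assumes arrows: "\<And>k. k < r \<Longrightarrow> src k < d \<and> tgt k < d \<and> is_source (src k) \<and> \<not> is_source (tgt k)"
    and total: "strict_total_on (quiver_vars r src tgt m) gt"
    and consistent: "\<And>\<gamma>. \<gamma> < d \<Longrightarrow> consistent_with gt (vertex_mat is_source r src tgt m \<gamma>)"
  shows "groebner_basis gt (quiver_vars r src tgt m)
           (\<Union>\<gamma>\<in>{..<d}. (minors (u \<gamma> + 1) (vertex_mat is_source r src tgt m \<gamma>) :: ('a::field) mpoly set))
           (ideal_gen (quiver_vars r src tgt m)
              (\<Union>\<gamma>\<in>{..<d}. (minors (u \<gamma> + 1) (vertex_mat is_source r src tgt m \<gamma>) :: ('a::field) mpoly set)))"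
proof -
  define V where "V = quiver_vars r src tgt m"
  define A where "A \<gamma> = vertex_mat is_source r src tgt m \<gamma>" for \<gamma>
  define W where "W \<gamma> = vertex_vars is_source r src tgt m \<gamma>" for \<gamma>
  define pos where "pos \<gamma> = vertex_pos is_source r src tgt m \<gamma>" for \<gamma>
  define G where "G = (\<Union>\<gamma>\<in>{..<d}. (minors (u \<gamma> + 1) (A \<gamma>) :: 'a mpoly set))"
  define \<theta> :: "qvar \<Rightarrow> (pvar \<Rightarrow>\<^sub>0 nat) \<Rightarrow>\<^sub>0 'a" where "\<theta> = rank_param tgt src u"
  define P where "P = blk_less fst row_ix col_ix tgt"
  define Q where "Q = blk_less fst col_ix row_ix src"
  note total = total[folded V_def]
  have finV: "finite V" unfolding V_def by (rule finite_quiver_vars)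
  have pl: "places (A \<gamma>) (W \<gamma>) (pos \<gamma>)" for \<gamma> unfolding A_def W_def pos_def by (rule vertex_places)
  have WV: "W \<gamma> \<subseteq> V" for \<gamma> by (auto simp: W_def V_def vertex_vars_def)
  have arr: "src (fst x) < d" "tgt (fst x) < d" "is_source (src (fst x))" "\<not> is_source (tgt (fst x))" if "x \<in> V" for x
    using arrows[of "fst x"] that by (auto simp: V_def quiver_vars_def)
  have tgtW: "x \<in> W (tgt (fst x))" if "x \<in> V" for x
    using arr[OF that] that by (simp add: W_def V_def vertex_vars_def)
  have srcW: "x \<in> W (src (fst x))" if "x \<in> V" for x
    using arr[OF that] that by (simp add: W_def V_def vertex_vars_def)
  have pos_sink: "pos \<gamma> x = (row_ix x, index_of (sink_cols r src tgt m \<gamma>) (fst x, col_ix x))"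
    if "\<not> is_source \<gamma>" for \<gamma> x using that by (simp add: pos_def vertex_pos_def)
  have pos_source: "pos \<gamma> x = (index_of (source_rows r src tgt m \<gamma>) (fst x, row_ix x), col_ix x)"
    if "is_source \<gamma>" for \<gamma> x using that by (simp add: pos_def vertex_pos_def)
  have gtP: "gt x y" if "x \<in> V" "y \<in> V" "tgt (fst x) = tgt (fst y)" "row_ix x \<le> row_ix y"
    "fst x < fst y \<or> fst x = fst y \<and> col_ix x \<le> col_ix y" "x \<noteq> y" for x y
  proof (rule consistent_gt[OF total consistent[OF arr(2)[OF that(1)], folded A_def] pl WV])
    show "x \<in> W (tgt (fst x))" "y \<in> W (tgt (fst x))" using tgtW[OF that(1)] tgtW[OF that(2)] that(3) by simp_all
    have "index_of (sink_cols r src tgt m (tgt (fst x))) (fst x, col_ix x)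
        \<le> index_of (sink_cols r src tgt m (tgt (fst x))) (fst y, col_ix y)"
      using that by (intro index_of_mono[OF sink_cols_lex(1)] in_set_sink_cols) (simp_all add: V_def)
    then show "fst (pos (tgt (fst x)) x) \<le> fst (pos (tgt (fst x)) y)"
      "snd (pos (tgt (fst x)) x) \<le> snd (pos (tgt (fst x)) y)"
      using pos_sink[OF arr(4)[OF that(1)]] that(4) by simp_all
  qed (rule that)
  have gtQ: "gt x y" if "x \<in> V" "y \<in> V" "src (fst x) = src (fst y)" "col_ix x \<le> col_ix y"
    "fst x < fst y \<or> fst x = fst y \<and> row_ix x \<le> row_ix y" "x \<noteq> y" for x y
  proof (rule consistent_gt[OF total consistent[OF arr(1)[OF that(1)], folded A_def] pl WV])
    show "x \<in> W (src (fst x))" "y \<in> W (src (fst x))" using srcW[OF that(1)] srcW[OF that(2)] that(3) by simp_all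
    have "index_of (source_rows r src tgt m (src (fst x))) (fst x, row_ix x)
        \<le> index_of (source_rows r src tgt m (src (fst x))) (fst y, row_ix y)"
      using that by (intro index_of_mono[OF source_rows_lex(1)] in_set_source_rows) (simp_all add: V_def)
    then show "fst (pos (src (fst x)) x) \<le> fst (pos (src (fst x)) y)"
      "snd (pos (src (fst x)) x) \<le> snd (pos (src (fst x)) y)"
      using pos_source[OF arr(3)[OF that(1)]] that(4) by simp_all
  qed (rule that)
  have posP: "fst (pos \<gamma> x) < fst (pos \<gamma> y) \<and> snd (pos \<gamma> x) < snd (pos \<gamma> y)"
    if "\<not> is_source \<gamma>" "x \<in> W \<gamma>" "y \<in> W \<gamma>" "P x y" for x y \<gamma>
  proof -
    have W: "x \<in> V" "y \<in> V" "tgt (fst x) = \<gamma>" "tgt (fst y) = \<gamma>"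
      using that(1-3) by (simp_all add: W_def vertex_vars_def V_def)
    have "index_of (sink_cols r src tgt m \<gamma>) (fst x, col_ix x) < index_of (sink_cols r src tgt m \<gamma>) (fst y, col_ix y)"
      using W that(4) by (intro index_of_less[OF sink_cols_lex(1)] in_set_sink_cols)
        (simp_all add: V_def P_def blk_less_def lex_less_def)
    then show ?thesis using that(4) by (simp add: pos_sink[OF that(1)] P_def blk_less_def)
  qed
  have posQ: "fst (pos \<gamma> x) < fst (pos \<gamma> y) \<and> snd (pos \<gamma> x) < snd (pos \<gamma> y)"
    if "is_source \<gamma>" "x \<in> W \<gamma>" "y \<in> W \<gamma>" "Q x y" for x y \<gamma>
  proof -
    have W: "x \<in> V" "y \<in> V" "src (fst x) = \<gamma>" "src (fst y) = \<gamma>"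
      using that(1-3) by (simp_all add: W_def vertex_vars_def V_def)
    have "index_of (source_rows r src tgt m \<gamma>) (fst x, row_ix x) < index_of (source_rows r src tgt m \<gamma>) (fst y, row_ix y)"
      using W that(4) by (intro index_of_less[OF source_rows_lex(1)] in_set_source_rows)
        (simp_all add: V_def Q_def blk_less_def lex_less_def)
    then show ?thesis using that(4) by (simp add: pos_source[OF that(1)] Q_def blk_less_def)
  qed
  have GV: "in_KX V g" if g: "g \<in> G" for g
  proof -
    obtain \<gamma> R C where "g = minor (A \<gamma>) R C" "R \<subseteq> {..<fst (A \<gamma>)}" "C \<subseteq> {..<fst (snd (A \<gamma>))}"
      "card R = u \<gamma> + 1" "card C = u \<gamma> + 1"
      using g unfolding G_def minors_def by blast
    then show ?thesis using in_KX_minor[OF pl WV, of R \<gamma> C] by simp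
  qed
  have G0: "subst_poly V \<theta> g = 0" if "g \<in> G" for g
    using that subst_vertex_minor unfolding G_def A_def V_def \<theta>_def by blast
  have I: "in_KX V f \<and> subst_poly V \<theta> f = 0" if "f \<in> ideal_gen V G" for f
    using that
  proof induction
    case zero
    show ?case by (simp add: in_KX_def)
  next
    case (add g c f)
    then show ?case using in_KX_mult_add[of V c g f] GV[of g] G0[of g] by (simp add: subst_poly_add subst_poly_mult)
  qed
  have "g \<in> ideal_gen V G" if "g \<in> G" for g
  proof -
    have "in_KX V (1 :: 'a mpoly)" by (simp add: in_KX_def)
    from ideal_gen.add[OF that this ideal_gen.zero] show ?thesis by simp
  qed
  moreover have "\<exists>g\<in>G. g \<noteq> 0 \<and> mon_dvd (lead_mon gt V g) (lead_mon gt V f)"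
    if fI: "f \<in> ideal_gen V G" "f \<noteq> 0" for f
  proof (rule ccontr)
    assume no: "\<not> ?thesis"
    define a where "a = lead_mon gt V f"
    define S where "S = Poly_Mapping.keys a"
    note f = I[OF fI(1)]
    have a: "a \<in> Poly_Mapping.keys f" "\<And>b. b \<in> Poly_Mapping.keys f \<Longrightarrow> b \<noteq> a \<Longrightarrow> lex_gt gt V a b"
      unfolding a_def using lead_mon_max[OF total finV, of f] f fI(2) by auto
    have keysV: "Poly_Mapping.keys b \<subseteq> V" if "b \<in> Poly_Mapping.keys f" for b
      using f that unfolding in_KX_def by blast
    have SV: "S \<subseteq> V" unfolding S_def by (rule keysV[OF a(1)])
    \<comment> \<open>This is where the assumption on \<open>f\<close> is spent: a chain of this
      size in the support of \<open>a\<close> gives a generator whose leading monomial divides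
      \<open>a\<close>.\<close>
    have no_chain: False
      if C: "C \<subseteq> S" "C \<subseteq> W \<gamma>" "chain_of R C" "card C = Suc (u \<gamma>)" "\<gamma> < d"
        "\<And>x y. x \<in> W \<gamma> \<Longrightarrow> y \<in> W \<gamma> \<Longrightarrow> R x y \<Longrightarrow> fst (pos \<gamma> x) < fst (pos \<gamma> y) \<and> snd (pos \<gamma> x) < snd (pos \<gamma> y)"
      for C \<gamma> R
    proof -
      obtain g :: "'a mpoly" where g: "g \<in> minors (Suc (u \<gamma>)) (A \<gamma>)" "g \<noteq> 0"
        "\<forall>a. C \<subseteq> Poly_Mapping.keys a \<longrightarrow> mon_dvd (lead_mon gt V g) a"
        using minor_of_chain[OF total consistent[OF C(5), folded A_def] pl WV C(2,3,4,6)] by blast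
      then have "g \<in> G" "mon_dvd (lead_mon gt V g) a" using C(1,5) by (auto simp: G_def S_def)
      then show False using no g(2) unfolding a_def by blast
    qed
    have finS: "finite S" by (simp add: S_def)
    \<comment> \<open>The relation \<open>P\<close> compares only variables with the same target, so
      a chain ending in \<open>x\<close> stays inside one sink matrix and has a minor of that matrix
      as its obstruction.\<close>
    have hP: "height P S x < u (tgt (fst x))" if "x \<in> S" for x
    proof (rule height_bound[OF finS _ _ that])
      fix C assume C: "C \<subseteq> S" "chain_of P C" "\<forall>y\<in>C. y = x \<or> P y x"
      have xV: "x \<in> V" using that SV by auto
      have "C \<subseteq> W (tgt (fst x))"
      proof
        fix y assume y: "y \<in> C"
        then have "tgt (fst y) = tgt (fst x)" using C(3) by (auto simp: P_def blk_less_def)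
        then show "y \<in> W (tgt (fst x))" using tgtW[of y] y C(1) SV by auto
      qed
      then show "card C \<noteq> Suc (u (tgt (fst x)))"
        using no_chain[OF C(1) _ C(2) _ _ posP[OF arr(4)[OF xV]]] arr(1,2)[OF xV] by blast
    qed (simp_all add: P_def transp_blk_less irreflp_blk_less)
    have hQ: "height Q S x < u (src (fst x))" if "x \<in> S" for x
    proof (rule height_bound[OF finS _ _ that])
      fix C assume C: "C \<subseteq> S" "chain_of Q C" "\<forall>y\<in>C. y = x \<or> Q y x"
      have xV: "x \<in> V" using that SV by auto
      have "C \<subseteq> W (src (fst x))"
      proof
        fix y assume y: "y \<in> C"
        then have "src (fst y) = src (fst x)" using C(3) by (auto simp: Q_def blk_less_def)
        then show "y \<in> W (src (fst x))" using srcW[of y] y C(1) SV by auto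
      qed
      then show "card C \<noteq> Suc (u (src (fst x)))"
        using no_chain[OF C(1) _ C(2) _ _ posQ[OF arr(3)[OF xV]]] arr(1,2)[OF xV] by blast
    qed (simp_all add: Q_def transp_blk_less irreflp_blk_less)
    define c0 where "c0 x = (height P S x, height Q S x)" for x
    have c0: "c0 x \<in> colors tgt src u x" if "x \<in> S" for x
      using hP[OF that] hQ[OF that] by (simp add: c0_def colors_def)
    define \<mu> where "\<mu> = (\<Sum>i\<in>slots V a. color_weight tgt src (fst i) (c0 (fst i)))"
    define N where "N b = {cs \<in> PiE (slots V b) (\<lambda>i. colors tgt src u (fst i)).
        (\<Sum>i\<in>slots V b. color_weight tgt src (fst i) (cs i)) = \<mu>}" for b
    \<comment> \<open>Every monomial of \<open>f\<close> other than \<open>a\<close> is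
      lexicographically smaller, so \<open>coloring_unique\<close> applies to all of them.\<close>
    have uniq: "b = a \<and> (\<forall>i\<in>slots V b. cs i = c0 (fst i))"
      if b: "b \<in> Poly_Mapping.keys f" and cs: "cs \<in> N b" for b cs
    proof -
      have 1: "b = a \<or> lex_gt gt V a b" using a(2)[OF b] by blast
      have 2: "cs i \<in> colors tgt src u (fst i)" if "i \<in> slots V b" for i
        using cs that unfolding N_def by blast
      have 3: "(\<Sum>i\<in>slots V b. color_weight tgt src (fst i) (cs i)) = (\<Sum>i\<in>slots V a. color_weight tgt src (fst i)
          (height (blk_less fst row_ix col_ix tgt) (Poly_Mapping.keys a) (fst i),
           height (blk_less fst col_ix row_ix src) (Poly_Mapping.keys a) (fst i)))"
        using cs unfolding N_def \<mu>_def c0_def P_def Q_def S_def by simp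
      note u = coloring_unique[OF total finV keysV[OF a(1)] keysV[OF b] gtP gtQ
          c0[unfolded c0_def P_def Q_def S_def] 2 3 1]
      show ?thesis using u unfolding c0_def P_def Q_def S_def by blast
    qed
    \<comment> \<open>Functions in \<open>PiE\<close> are fixed outside their domain, so agreement
      on the slots leaves a single function. Its contribution to the coefficient is therefore
      exactly 1.\<close>
    have Na: "N a = {restrict (\<lambda>i. c0 (fst i)) (slots V a)}"
    proof (intro equalityI subsetI)
      fix cs assume cs: "cs \<in> N a"
      then have "cs = restrict (\<lambda>i. c0 (fst i)) (slots V a)"
        using uniq[OF a(1) cs] by (intro extensionalityI[of _ "slots V a"]) (auto simp: N_def PiE_def)
      then show "cs \<in> {restrict (\<lambda>i. c0 (fst i)) (slots V a)}" by simp
    next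
      fix cs assume cs: "cs \<in> {restrict (\<lambda>i. c0 (fst i)) (slots V a)}"
      have "c0 (fst i) \<in> colors tgt src u (fst i)" if "i \<in> slots V a" for i
        using that by (intro c0) (auto simp: S_def in_keys_iff)
      moreover have "(\<Sum>i\<in>slots V a. color_weight tgt src (fst i) (cs i)) = \<mu>"
        unfolding \<mu>_def using cs by (intro sum.cong) auto
      ultimately show "cs \<in> N a" using cs unfolding N_def by auto
    qed
    have "Poly_Mapping.lookup (\<Prod>x\<in>V. \<theta> x ^ Poly_Mapping.lookup b x) \<mu> = of_nat (card (N b))" for b
      unfolding \<theta>_def rank_param_def N_def by (rule lookup_prod_sum_single[OF finV]) simp
    then have "Poly_Mapping.lookup (subst_poly V \<theta> f) \<mu>
        = (\<Sum>b\<in>Poly_Mapping.keys f. Poly_Mapping.lookup f b * of_nat (card (N b)))"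
      unfolding subst_poly_def lookup_sum by (simp add: lookup_const_mult)
    \<comment> \<open>A smaller monomial of \<open>f\<close> has no colouring of weight \<mu>, so it
      cannot cancel the contribution of \<open>a\<close>.\<close>
    also have "\<dots> = (\<Sum>b\<in>{a}. Poly_Mapping.lookup f b * of_nat (card (N b)))"
    proof (rule sum.mono_neutral_right)
      show "\<forall>b\<in>Poly_Mapping.keys f - {a}. Poly_Mapping.lookup f b * of_nat (card (N b)) = 0"
      proof
        fix b assume b: "b \<in> Poly_Mapping.keys f - {a}"
        have "N b = {}" using b uniq[of b] by fast
        then show "Poly_Mapping.lookup f b * of_nat (card (N b)) = 0" by simp
      qed
    qed (use a(1) in auto)
    also have "\<dots> = Poly_Mapping.lookup f a" by (simp add: Na)
    finally have "Poly_Mapping.lookup (subst_poly V \<theta> f) \<mu> = Poly_Mapping.lookup f a" .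
    then show False using f a(1) by (simp add: in_keys_iff)
  qed
  ultimately show ?thesis unfolding groebner_basis_def V_def G_def A_def by blast
qed

end
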